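(* There is an algorithm which, given a $321$-avoiding permutation $\tau$ of size $n$ and a $321$-avoiding permutation $\pi$ of size $k$, determines whether $\tau$ contains $\pi$, and whose running time is $O(kn)$.
   Context: A permutation of size $n$ is a bijection $\sigma:[n]\to[n]$, $[n]=\{1,\dots,n\}$, identified with its set of points $\{(i,\sigma(i))\}$. A point $(i,\sigma(i))$ lies to the left of $(j,\sigma(j))$ if $i<j$ and below it if $\sigma(i)<\sigma(j)$. An embedding of $\pi$ into $\tau$ is an injective map $f$ from the points of $\pi$ to the points of $\tau$ such that for all points $x,y$ of $\pi$, $f(x),f(y)$ are in the same relative horizontal and vertical order as $x,y$. $\tau$ contains $\pi$ if such an embedding exists. A permutation is $321$-avoiding if it contains no three points $a,b,c$ with $a$ left of $b$ left of $c$ and $a$ above $b$ above $c$. Running time is measured in the standard RAM model with $\pi,\tau$ given in one-line notation. *)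

theory Defs
  imports Main
begin

text \<open>A permutation of size n is a bijection of {1..n}, given as a function nat => nat
  (only its values on {1..n} matter; these form its one-line notation).\<close>
definition is_perm :: "nat \<Rightarrow> (nat \<Rightarrow> nat) \<Rightarrow> bool" where
  "is_perm n \<sigma> \<longleftrightarrow> bij_betw \<sigma> {1..n} {1..n}"

definition points :: "nat \<Rightarrow> (nat \<Rightarrow> nat) \<Rightarrow> (nat \<times> nat) set" where
  "points n \<sigma> = {(i, \<sigma> i) | i. i \<in> {1..n}}"

definition is_embedding ::
  "nat \<Rightarrow> (nat \<Rightarrow> nat) \<Rightarrow> nat \<Rightarrow> (nat \<Rightarrow> nat) \<Rightarrow> (nat \<times> nat \<Rightarrow> nat \<times> nat) \<Rightarrow> bool" where
  "is_embedding k \<pi> n \<tau> f \<longleftrightarrow>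
     f ` points k \<pi> \<subseteq> points n \<tau> \<and> inj_on f (points k \<pi>) \<and>
     (\<forall>x\<in>points k \<pi>. \<forall>y\<in>points k \<pi>.
        (fst x < fst y \<longleftrightarrow> fst (f x) < fst (f y)) \<and>
        (snd x < snd y \<longleftrightarrow> snd (f x) < snd (f y)))"

definition contains :: "nat \<Rightarrow> (nat \<Rightarrow> nat) \<Rightarrow> nat \<Rightarrow> (nat \<Rightarrow> nat) \<Rightarrow> bool" where
  "contains n \<tau> k \<pi> \<longleftrightarrow> (\<exists>f. is_embedding k \<pi> n \<tau> f)"

definition avoids_321 :: "nat \<Rightarrow> (nat \<Rightarrow> nat) \<Rightarrow> bool" where
  "avoids_321 n \<sigma> \<longleftrightarrow>
     \<not> (\<exists>a b c. a \<in> {1..n} \<and> b \<in> {1..n} \<and> c \<in> {1..n} \<and> a < b \<and> b < c \<and>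
              \<sigma> a > \<sigma> b \<and> \<sigma> b > \<sigma> c)"

text \<open>Memory: integer-addressed cells holding integers. Instructions (unit cost each):
  constant load, addition, subtraction, indirect load/store, conditional jump.
  The machine halts when the program counter leaves the program.\<close>

datatype instr =
    LoadC int int
  | Add int int int
  | Sub int int int
  | LoadI int int
  | StoreI int int
  | JumpLE int int nat

type_synonym config = "nat \<times> (int \<Rightarrow> int)"

fun exec_instr :: "instr \<Rightarrow> config \<Rightarrow> config" where
  "exec_instr (LoadC d c) (pc, m) = (pc + 1, m(d := c))"
| "exec_instr (Add d a b) (pc, m) = (pc + 1, m(d := m a + m b))"
| "exec_instr (Sub d a b) (pc, m) = (pc + 1, m(d := m a - m b))"
| "exec_instr (LoadI d a) (pc, m) = (pc + 1, m(d := m (m a)))"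
| "exec_instr (StoreI d a) (pc, m) = (pc + 1, m(m d := m a))"
| "exec_instr (JumpLE a b l) (pc, m) = (if m a \<le> m b then (l, m) else (pc + 1, m))"

definition halted :: "instr list \<Rightarrow> config \<Rightarrow> bool" where
  "halted P c \<longleftrightarrow> fst c \<ge> length P"

definition step :: "instr list \<Rightarrow> config \<Rightarrow> config" where
  "step P c = (if halted P c then c else exec_instr (P ! fst c) c)"

definition init_mem :: "nat \<Rightarrow> (nat \<Rightarrow> nat) \<Rightarrow> nat \<Rightarrow> (nat \<Rightarrow> nat) \<Rightarrow> int \<Rightarrow> int" where
  "init_mem n \<tau> k \<pi> = (\<lambda>a.
     if a = 0 then int n
     else if a = 1 then int k
     else if 2 \<le> a \<and> a \<le> int n + 1 then int (\<tau> (nat (a - 1)))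
     else if int n + 2 \<le> a \<and> a \<le> int n + int k + 1 then int (\<pi> (nat (a - 1 - int n)))
     else 0)"

end

theory Submission
  imports Defs
begin

text \<open>In a 321-avoiding permutation the points with \<open>\<sigma> i > i\<close> are exactly those starting an inversion,
  the points with \<open>\<sigma> i < i\<close> exactly those ending one, and the fixed points lie in no inversion. The
  points with \<open>i \<le> \<sigma> i\<close> and those with \<open>\<sigma> i < i\<close> form two increasing chains. An embedding sends
  non-fixed pattern points to the chain of their own kind; along a chain, position and value grow
  together, so the constraints between horizontally or vertically consecutive pattern points are
  monotone and have a least solution, found by advancing pointers until nothing is violated.

  A fixed pattern point may go to either chain, but it splits the pattern into a left-below and a
  right-above part. Hence it is enough to keep two pointers per pattern position, one for each
  chain to which the preceding fixed point may be sent; a fixed point itself only has to be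
  compatible with one of the two copies of the part before it. A work list of nodes whose
  constraints may have become violated bounds the running time by the \<open>2k(n + 1)\<close> pointer moves.\<close>

section \<open>Permutations avoiding 321\<close>

text \<open>The vertical constraints are the obstacle. A lower bound on the position of an image is
  of use for them only if it also bounds the value of the image, and this holds only along one
  chain: of two text points on different chains the left one may be the higher. Hence every pointer
  needs a known chain. This is exactly what a fixed pattern point lacks and what the copies restore.
  Correctness then has two halves. No pointer passes an embedding whose own choices select the copy
  of that pointer, so failure is conclusive. Conversely, a stable state with a finite pointer at the
  last position yields an embedding, glued at the fixed points from segments of possibly different
  copies. The order in which the work list is processed is immaterial; a stack makes insertion and
  removal take constant time. The bound is \<open>k * n + 1\<close> instead of \<open>k * n\<close>
  because the machine needs some steps even if \<open>k\<close> or \<open>n\<close> is zero.\<close>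

lemma is_perm_in: "is_perm n \<sigma> \<Longrightarrow> i \<in> {1..n} \<Longrightarrow> \<sigma> i \<in> {1..n}"
  by (auto simp: is_perm_def bij_betw_def)

lemma is_perm_eq_iff:
  "is_perm n \<sigma> \<Longrightarrow> i \<in> {1..n} \<Longrightarrow> j \<in> {1..n} \<Longrightarrow> \<sigma> i = \<sigma> j \<longleftrightarrow> i = j"
  by (meson bij_betw_def inj_on_eq_iff is_perm_def)

lemma is_perm_surj: "is_perm n \<sigma> \<Longrightarrow> y \<in> {1..n} \<Longrightarrow> \<exists>i\<in>{1..n}. \<sigma> i = y"
  unfolding is_perm_def bij_betw_def by (metis imageE)

lemma avoids_321D:
  assumes "avoids_321 n \<sigma>" "a \<in> {1..n}" "c \<in> {1..n}" "a < b" "b < c" "\<sigma> b < \<sigma> a" "\<sigma> c < \<sigma> b"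
  shows False
proof -
  have "b \<in> {1..n}" using assms by simp
  then show False using assms unfolding avoids_321_def by blast
qed

text \<open>Pigeonhole: otherwise the \<open>i - 1\<close> earlier positions would share the
  \<open>\<sigma> i - 1\<close> values below \<open>\<sigma> i\<close>, too few for an injective
  map.\<close>

lemma larger_before:
  assumes "is_perm n \<sigma>" "i \<in> {1..n}" "\<sigma> i < i"
  shows "\<exists>j\<in>{1..<i}. \<sigma> i < \<sigma> j"
proof (rule ccontr)
  assume neg: "\<not> ?thesis"
  have "\<sigma> j \<in> {1..<\<sigma> i}" if "j \<in> {1..<i}" for j
    using neg that assms(2) is_perm_in[OF assms(1), of j] is_perm_eq_iff[OF assms(1), of i j]
    by (cases "\<sigma> j" "\<sigma> i" rule: linorder_cases) auto
  then have "\<sigma> ` {1..<i} \<subseteq> {1..<\<sigma> i}" by auto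
  moreover have "inj_on \<sigma> {1..<i}"
    using assms(1,2) unfolding is_perm_def bij_betw_def by (auto intro: inj_on_subset)
  ultimately have "card {1..<i} \<le> card {1..<\<sigma> i}"
    by (metis card_inj_on_le finite_atLeastLessThan)
  then show False
    using assms is_perm_in[OF assms(1,2)] by simp
qed

text \<open>The dual count: otherwise all values below \<open>\<sigma> i\<close> would sit at the
  \<open>i - 1\<close> earlier positions, which are too few.\<close>

lemma smaller_after:
  assumes "is_perm n \<sigma>" "i \<in> {1..n}" "i < \<sigma> i"
  shows "\<exists>j\<in>{i<..n}. \<sigma> j < \<sigma> i"
proof (rule ccontr)
  assume neg: "\<not> ?thesis"
  have "{1..<\<sigma> i} \<subseteq> \<sigma> ` {1..<i}"
  proof
    fix y assume y: "y \<in> {1..<\<sigma> i}"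
    then obtain j where j: "j \<in> {1..n}" "\<sigma> j = y"
      using is_perm_surj[OF assms(1), of y] is_perm_in[OF assms(1,2)] by auto
    with y neg have "j < i" by (cases j i rule: linorder_cases) auto
    with j show "y \<in> \<sigma> ` {1..<i}" by auto
  qed
  then have "card {1..<\<sigma> i} \<le> card {1..<i}"
    by (meson card_image_le card_mono finite_atLeastLessThan finite_imageI le_trans)
  then show False using assms by auto
qed

text \<open>A point before \<open>z\<close> that rises above it leaves a gap among the values below
  \<open>z\<close>; a point after \<open>z\<close> must fill the gap and completes a 321 with
  \<open>z\<close> in the middle. The second claim follows by counting, since the points before
  \<open>z\<close> then use up all values below it.\<close>

lemma fixed_splits:
  assumes "is_perm n \<sigma>" "avoids_321 n \<sigma>" "z \<in> {1..n}" "\<sigma> z = z" "y \<in> {1..n}"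
  shows "y < z \<Longrightarrow> \<sigma> y < z" "z < y \<Longrightarrow> z < \<sigma> y"
proof -
  have before: "\<sigma> a < z" if a: "a \<in> {1..n}" "a < z" for a
  proof (rule ccontr)
    assume "\<not> \<sigma> a < z"
    with a is_perm_eq_iff[OF assms(1), of a z] assms have az: "z < \<sigma> a" by fastforce
    have "\<not> {1..<z} \<subseteq> \<sigma> ` ({1..<z} - {a})"
    proof
      assume "{1..<z} \<subseteq> \<sigma> ` ({1..<z} - {a})"
      then have "card {1..<z} \<le> card ({1..<z} - {a})"
        by (meson card_image_le card_mono finite_Diff finite_atLeastLessThan finite_imageI le_trans)
      moreover have "card ({1..<z} - {a}) < card {1..<z}"
        using a by (intro card_Diff1_less) auto
      ultimately show False by simp
    qed
    then obtain v where v: "v \<in> {1..<z}" "v \<notin> \<sigma> ` ({1..<z} - {a})" by blast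
    then obtain w where w: "w \<in> {1..n}" "\<sigma> w = v"
      using is_perm_surj[OF assms(1), of v] assms(3) by auto
    have "w \<noteq> a" "w \<noteq> z" using w v az assms(4) by auto
    with v w have "z < w" by (cases w z rule: linorder_cases) auto
    then show False
      using avoids_321D[OF assms(2), of a w z] assms(4) a az v w by auto
  qed
  then show "y < z \<Longrightarrow> \<sigma> y < z" using assms(5) by blast
  assume "z < y"
  show "z < \<sigma> y"
  proof (rule ccontr)
    assume "\<not> z < \<sigma> y"
    with \<open>z < y\<close> is_perm_eq_iff[OF assms(1), of y z] assms have lt: "\<sigma> y < z" by fastforce
    have "\<sigma> ` {1..<z} \<subseteq> {1..<z} - {\<sigma> y}"
    proof
      fix v assume "v \<in> \<sigma> ` {1..<z}"
      then obtain a where a: "a \<in> {1..<z}" "v = \<sigma> a" by auto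
      then show "v \<in> {1..<z} - {\<sigma> y}"
        using before[of a] is_perm_in[OF assms(1), of a] is_perm_eq_iff[OF assms(1), of a y]
          assms(3,5) \<open>z < y\<close> by auto
    qed
    moreover have "inj_on \<sigma> {1..<z}"
      using assms(1,3) unfolding is_perm_def bij_betw_def by (auto intro: inj_on_subset)
    ultimately have "card {1..<z} \<le> card ({1..<z} - {\<sigma> y})"
      by (metis card_inj_on_le finite_Diff finite_atLeastLessThan)
    moreover have "card ({1..<z} - {\<sigma> y}) < card {1..<z}"
      using lt is_perm_in[OF assms(1,5)] by (intro card_Diff1_less) auto
    ultimately show False by simp
  qed
qed

text \<open>If \<open>x\<close> were below the diagonal, a larger value before it would extend the
  inversion to a 321.\<close>

lemma upper_if_inversion:
  assumes "is_perm n \<sigma>" "avoids_321 n \<sigma>" "x \<in> {1..n}" "y \<in> {1..n}" "x < y" "\<sigma> y < \<sigma> x"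
  shows "x \<le> \<sigma> x"
proof (rule ccontr)
  assume "\<not> x \<le> \<sigma> x"
  then obtain h where "h \<in> {1..<x}" "\<sigma> x < \<sigma> h"
    using larger_before[OF assms(1,3)] by auto
  then show False using avoids_321D[OF assms(2), of h y x] assms by auto
qed

text \<open>The end \<open>y\<close> cannot be fixed, because it has a higher point to its left, nor
  lie above the diagonal, because a later smaller value would extend the inversion to a 321.\<close>

lemma lower_if_inversion:
  assumes "is_perm n \<sigma>" "avoids_321 n \<sigma>" "x \<in> {1..n}" "y \<in> {1..n}" "x < y" "\<sigma> y < \<sigma> x"
  shows "\<sigma> y < y"
proof (rule ccontr)
  assume "\<not> \<sigma> y < y"
  then consider "\<sigma> y = y" | "y < \<sigma> y" by linarith
  then show False
  proof cases
    case 1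
    then show False using fixed_splits(1)[OF assms(1,2,4) _ assms(3)] assms by auto
  next
    case 2
    then obtain h where "h \<in> {y<..n}" "\<sigma> h < \<sigma> y"
      using smaller_after[OF assms(1,4)] by auto
    then show False using avoids_321D[OF assms(2), of x h y] assms by auto
  qed
qed

text \<open>Every inversion leads from one class to the other, so none stays inside a class. Fixed
  points count as upper here.\<close>

lemma chain_mono:
  assumes "is_perm n \<sigma>" "avoids_321 n \<sigma>" "i \<in> {1..n}" "j \<in> {1..n}" "i < j"
    and "i \<le> \<sigma> i \<longleftrightarrow> j \<le> \<sigma> j"
  shows "\<sigma> i < \<sigma> j"
proof (rule ccontr)
  assume "\<not> \<sigma> i < \<sigma> j"
  with is_perm_eq_iff[OF assms(1), of i j] assms have "\<sigma> j < \<sigma> i" by fastforce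
  then show False
    using upper_if_inversion[OF assms(1-5)] lower_if_inversion[OF assms(1-5)] assms(6) by simp
qed

section \<open>Embeddings as maps of positions\<close>

definition is_position_embedding ::
  "nat \<Rightarrow> (nat \<Rightarrow> nat) \<Rightarrow> nat \<Rightarrow> (nat \<Rightarrow> nat) \<Rightarrow> (nat \<Rightarrow> nat) \<Rightarrow> bool" where
  "is_position_embedding k \<pi> n \<tau> g \<longleftrightarrow> (\<forall>x\<in>{1..k}. g x \<in> {1..n}) \<and>
     (\<forall>x\<in>{1..k}. \<forall>y\<in>{1..k}. (x < y \<longrightarrow> g x < g y) \<and> (\<pi> x < \<pi> y \<longrightarrow> \<tau> (g x) < \<tau> (g y)))"

text \<open>A position map is asked only for the forward implications. Positions and values of the
  pattern are strictly and totally ordered, so the converse implications and injectivity follow by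
  trichotomy.\<close>

lemma contains_iff_position_embedding:
  assumes "is_perm k \<pi>"
  shows "contains n \<tau> k \<pi> \<longleftrightarrow> (\<exists>g. is_position_embedding k \<pi> n \<tau> g)"
proof
  assume "contains n \<tau> k \<pi>"
  then obtain f where f: "is_embedding k \<pi> n \<tau> f" unfolding contains_def by blast
  define g where "g x = fst (f (x, \<pi> x))" for x
  have pt: "(x, \<pi> x) \<in> points k \<pi>" if "x \<in> {1..k}" for x
    using that by (auto simp: points_def)
  have im: "g x \<in> {1..n} \<and> f (x, \<pi> x) = (g x, \<tau> (g x))" if "x \<in> {1..k}" for x
  proof -
    have "f (x, \<pi> x) \<in> points n \<tau>"
      using f pt[OF that] unfolding is_embedding_def by blast
    then show ?thesis by (auto simp: points_def g_def)
  qed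
  have "(x < y \<longrightarrow> g x < g y) \<and> (\<pi> x < \<pi> y \<longrightarrow> \<tau> (g x) < \<tau> (g y))"
    if "x \<in> {1..k}" "y \<in> {1..k}" for x y
    using f pt[OF that(1)] pt[OF that(2)] im[OF that(1)] im[OF that(2)]
    unfolding is_embedding_def by fastforce
  then show "\<exists>g. is_position_embedding k \<pi> n \<tau> g"
    unfolding is_position_embedding_def using im by blast
next
  assume "\<exists>g. is_position_embedding k \<pi> n \<tau> g"
  then obtain g where gp: "is_position_embedding k \<pi> n \<tau> g" by blast
  have g: "\<And>x. x \<in> {1..k} \<Longrightarrow> g x \<in> {1..n}"
    "\<And>x y. x \<in> {1..k} \<Longrightarrow> y \<in> {1..k} \<Longrightarrow> x < y \<Longrightarrow> g x < g y"
    "\<And>x y. x \<in> {1..k} \<Longrightarrow> y \<in> {1..k} \<Longrightarrow> \<pi> x < \<pi> y \<Longrightarrow> \<tau> (g x) < \<tau> (g y)"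
    using gp unfolding is_position_embedding_def by blast+
  have hor: "x < y \<longleftrightarrow> g x < g y" if "x \<in> {1..k}" "y \<in> {1..k}" for x y
    using g(2)[OF that] g(2)[OF that(2,1)] by (cases x y rule: linorder_cases) auto
  have ver: "\<pi> x < \<pi> y \<longleftrightarrow> \<tau> (g x) < \<tau> (g y)" if "x \<in> {1..k}" "y \<in> {1..k}" for x y
    using g(3)[OF that] g(3)[OF that(2,1)] is_perm_eq_iff[OF assms that]
    by (cases "\<pi> x" "\<pi> y" rule: linorder_cases) auto
  have "is_embedding k \<pi> n \<tau> (\<lambda>(x, _). (g x, \<tau> (g x)))"
    unfolding is_embedding_def
  proof (intro conjI ballI)
    show "(\<lambda>(x, _). (g x, \<tau> (g x))) ` points k \<pi> \<subseteq> points n \<tau>"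
      using g(1) by (auto simp: points_def)
    show "inj_on (\<lambda>(x, _). (g x, \<tau> (g x))) (points k \<pi>)"
    proof (rule inj_onI)
      fix a b assume ab: "a \<in> points k \<pi>" "b \<in> points k \<pi>"
        "(case a of (x, _) \<Rightarrow> (g x, \<tau> (g x))) = (case b of (x, _) \<Rightarrow> (g x, \<tau> (g x)))"
      then obtain x y where "a = (x, \<pi> x)" "b = (y, \<pi> y)" "x \<in> {1..k}" "y \<in> {1..k}"
        unfolding points_def by blast
      then show "a = b"
        using ab(3) hor[of x y] hor[of y x] by (cases x y rule: linorder_cases) auto
    qed
  qed (auto simp: points_def hor ver)
  then show "contains n \<tau> k \<pi>" unfolding contains_def by blast
qed

text \<open>Justifies rejecting \<open>k > n\<close> at once. Otherwise, for instance with
  \<open>n = 0\<close>, reading the pattern would already exceed the time bound.\<close>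

lemma contains_imp_le:
  assumes "contains n \<tau> k \<pi>" shows "k \<le> n"
proof -
  have card_points: "card (points m \<sigma>) = m" "finite (points m \<sigma>)" for m \<sigma>
  proof -
    have eq: "points m \<sigma> = (\<lambda>i. (i, \<sigma> i)) ` {1..m}" by (auto simp: points_def)
    show "card (points m \<sigma>) = m" "finite (points m \<sigma>)"
      unfolding eq by (simp_all add: card_image inj_on_def)
  qed
  from assms show ?thesis
    unfolding contains_def is_embedding_def by (metis card_inj_on_le card_points)
qed

lemma less_if_pred_less:
  fixes h :: "nat \<Rightarrow> nat"
  assumes "\<And>i. i \<in> {1..k} \<Longrightarrow> h (i - 1) < h i" "i < j" "j \<le> k"
  shows "h i < h j"
  using assms(2,3)
proof (induction j)
  case (Suc j)
  then show ?case using assms(1)[of "Suc j"] by (cases "i = j") auto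
qed simp

section \<open>The pointer search\<close>

locale matching =
  fixes n k :: nat and T \<pi> :: "nat \<Rightarrow> nat"
  assumes perm_T: "is_perm n T" and avoids_T: "avoids_321 n T" and T_0: "T 0 = 0"
    and perm_pi: "is_perm k \<pi>" and avoids_pi: "avoids_321 k \<pi>"
begin

text \<open>Position \<open>0\<close> is a sentinel for a missing neighbour below or above. Its
  pointers stay \<open>0\<close> and \<open>T 0 = 0\<close>, so a missing lower neighbour constrains
  nothing.\<close>

definition pos_of :: "nat \<Rightarrow> nat" where
  "pos_of y = (if y \<in> {1..k} then inv_into {1..k} \<pi> y else 0)"

lemma pos_of_pi: "x \<in> {1..k} \<Longrightarrow> pos_of (\<pi> x) = x"
  using perm_pi is_perm_in[OF perm_pi]
  by (auto simp: pos_of_def is_perm_def bij_betw_def)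

lemma pi_pos_of: "y \<in> {1..k} \<Longrightarrow> pos_of y \<in> {1..k} \<and> \<pi> (pos_of y) = y"
  using perm_pi by (metis pos_of_pi is_perm_surj)

lemma pos_of_outside: "y \<notin> {1..k} \<Longrightarrow> pos_of y = 0"
  by (auto simp: pos_of_def)

lemma pos_of_le: "pos_of y \<le> k"
  using pi_pos_of[of y] pos_of_outside[of y] by (cases "y \<in> {1..k}") auto

text \<open>Copy \<open>c\<close> of a pattern position \<open>x\<close> stands for the case that the last fixed point of \<open>\<pi>\<close> at or
  before \<open>x\<close> is sent to the upper (\<open>False\<close>) or lower (\<open>True\<close>) chain of the text. The pointer
  \<open>p c x\<close> is a lower bound for the image of \<open>x\<close>; \<open>0\<close> means not yet placed, \<open>n + 1\<close> impossible.\<close>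
definition supported :: "(bool \<Rightarrow> nat \<Rightarrow> nat) \<Rightarrow> bool \<Rightarrow> nat \<Rightarrow> nat \<Rightarrow> bool" where
  "supported p c x q \<longleftrightarrow> p c (x - 1) < q \<and> T (p c (pos_of (\<pi> x - 1))) < T q"

text \<open>Both neighbours of a fixed point are read in the same copy, since they belong to one
  embedded left-below part. That copy is independent of \<open>c\<close>, which only determines the
  chain of the fixed point itself.\<close>

definition good :: "(bool \<Rightarrow> nat \<Rightarrow> nat) \<Rightarrow> bool \<Rightarrow> nat \<Rightarrow> bool" where
  "good p c x \<longleftrightarrow>
     (if \<pi> x = x then supported p False x (p c x) \<or> supported p True x (p c x)
      else supported p c x (p c x))"

definition upper :: "bool \<Rightarrow> nat \<Rightarrow> bool" where
  "upper c x \<longleftrightarrow> x < \<pi> x \<or> \<pi> x = x \<and> \<not> c"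

definition on_chain :: "bool \<Rightarrow> nat \<Rightarrow> bool" where
  "on_chain u q \<longleftrightarrow> (u \<longleftrightarrow> q \<le> T q)"

section \<open>From stable pointers to an embedding\<close>

lemma position_embeddingI:
  assumes g0: "g 0 = 0"
    and g: "\<And>x. x \<in> {1..k} \<Longrightarrow> g (x - 1) < g x \<and> T (g (pos_of (\<pi> x - 1))) < T (g x) \<and> g x \<le> n"
  shows "is_position_embedding k \<pi> n T g"
  unfolding is_position_embedding_def
proof (intro conjI ballI impI)
  show "g x \<in> {1..n}" if "x \<in> {1..k}" for x using g[OF that] by auto
next
  fix x y assume "x \<in> {1..k}" "y \<in> {1..k}" "x < y"
  then show "g x < g y" using less_if_pred_less[of k g x y] g by auto
next
  fix x y assume xy: "x \<in> {1..k}" "y \<in> {1..k}" "\<pi> x < \<pi> y"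
  have "T (g (pos_of (i - 1))) < T (g (pos_of i))" if "i \<in> {1..k}" for i
    using g[of "pos_of i"] pi_pos_of[OF that] by simp
  then have "T (g (pos_of (\<pi> x))) < T (g (pos_of (\<pi> y)))"
    using less_if_pred_less[of k "\<lambda>i. T (g (pos_of i))" "\<pi> x" "\<pi> y"] xy is_perm_in[OF perm_pi]
    by auto
  then show "T (g x) < T (g y)" using xy pos_of_pi by simp
qed

definition stable :: "(bool \<Rightarrow> nat \<Rightarrow> nat) \<Rightarrow> bool" where
  "stable p \<longleftrightarrow> (\<forall>c. p c 0 = 0) \<and> (\<forall>c. \<forall>x\<in>{1..k}. p c x \<le> n \<longrightarrow> good p c x)"

text \<open>Going backwards, the copy changes only at fixed points, which separate their left-below
  part from their right-above part; there any copy that supports the fixed point will do.\<close>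
lemma stable_prefix:
  assumes "stable p" "m \<le> k" "p c m \<le> n" "\<And>x. x \<in> {1..k} \<Longrightarrow> x \<le> m \<longleftrightarrow> \<pi> x \<le> m"
  shows "\<exists>g. g 0 = 0 \<and> g m = p c m \<and> g (pos_of m) = p c (pos_of m) \<and>
    (\<forall>x\<in>{1..m}. g (x - 1) < g x \<and> T (g (pos_of (\<pi> x - 1))) < T (g x) \<and> g x \<le> n)"
  using assms(2-4)
proof (induction m arbitrary: c rule: less_induct)
  case (less m)
  have p0: "p c 0 = 0" for c using assms(1) by (simp add: stable_def)
  have gd: "good p c x" if "x \<in> {1..k}" "p c x \<le> n" for c x
    using assms(1) that by (simp add: stable_def)
  \<comment> \<open>In a stretch without fixed points every pointer lies below the next one of the
    same copy, so finiteness at \<open>m\<close> passes down to the start of the stretch.\<close>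
  have le_n: "p c x \<le> n" if "z \<le> x" "x \<le> m" "\<And>y. y \<in> {z<..m} \<Longrightarrow> \<pi> y \<noteq> y" for x z
    using that(2,1)
  proof (induction x rule: inc_induct)
    case (step x)
    then show ?case
      using gd[of "Suc x" c] that(3)[of "Suc x"] less.prems(1)
      by (auto simp: good_def supported_def)
  qed (use less.prems in simp)
  show ?case
  proof (cases "\<exists>z\<in>{1..m}. \<pi> z = z")
    case False
    have "p c (x - 1) < p c x \<and> T (p c (pos_of (\<pi> x - 1))) < T (p c x) \<and> p c x \<le> n"
      if "x \<in> {1..m}" for x
    proof -
      have "p c x \<le> n" using le_n[of 0 x] False that by fastforce
      moreover have "\<pi> x \<noteq> x" using False that by blast
      ultimately show ?thesis
        using gd[of x c] that less.prems(1) by (auto simp: good_def supported_def)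
    qed
    then show ?thesis using p0 by blast
  next
    case True
    define z where "z = Max {z \<in> {1..m}. \<pi> z = z}"
    have fin: "finite {z \<in> {1..m}. \<pi> z = z}" by simp
    have z: "z \<in> {1..m}" "\<pi> z = z"
      using Max_in[OF fin] True unfolding z_def by blast+
    have last: "\<pi> y \<noteq> y" if "y \<in> {z<..m}" for y
    proof
      assume "\<pi> y = y"
      then have "y \<le> z" unfolding z_def using that by (intro Max_ge) auto
      then show False using that by simp
    qed
    have zk: "z \<in> {1..k}" using z less.prems(1) by auto
    note split = fixed_splits[OF perm_pi avoids_pi zk z(2)]
    have pz: "p c z \<le> n" using le_n[of z z] last z by auto
    obtain c' where c': "supported p c' z (p c z)"
      using gd[OF zk pz] z(2) by (auto simp: good_def)
    have closed: "x \<le> z - 1 \<longleftrightarrow> \<pi> x \<le> z - 1" if "x \<in> {1..k}" for x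
      using split[OF that] z zk by (cases x z rule: linorder_cases) auto
    have "p c' (z - 1) \<le> n" using c' pz by (auto simp: supported_def)
    moreover have "z - 1 < m" "z - 1 \<le> k" using z zk by auto
    \<comment> \<open>Of the part before it, \<open>z\<close> reads only the left neighbour
      \<open>z - 1\<close> and the lower neighbour \<open>pos_of (z - 1)\<close>. This is why the
      induction records agreement with the pointers at \<open>m\<close> and at
      \<open>pos_of m\<close>.\<close>
    ultimately obtain g where g: "g 0 = 0" "g (z - 1) = p c' (z - 1)"
      "g (pos_of (z - 1)) = p c' (pos_of (z - 1))"
      "\<And>x. x \<in> {1..z - 1} \<Longrightarrow>
         g (x - 1) < g x \<and> T (g (pos_of (\<pi> x - 1))) < T (g x) \<and> g x \<le> n"
      using less.IH[of "z - 1" c'] closed by blast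
    define h where "h x = (if x < z then g x else p c x)" for x
    \<comment> \<open>Fixed points separate values as well: positions up to \<open>z\<close> read
      their lower neighbour in the part taken from \<open>g\<close>, later positions in the part
      taken from \<open>p c\<close>.\<close>
    have ivz: "pos_of (y - 1) < z \<longleftrightarrow> y \<le> z" if "y \<in> {1..k}" for y
    proof (cases "y = 1")
      case True
      then show ?thesis using pos_of_outside[of 0] z by auto
    next
      case False
      then have "y - 1 \<in> {1..k}" using that by auto
      then have "pos_of (y - 1) \<in> {1..k}" "\<pi> (pos_of (y - 1)) = y - 1" using pi_pos_of by blast+
      then show ?thesis using split[of "pos_of (y - 1)"] z(2) that False
        by (cases "pos_of (y - 1)" z rule: linorder_cases) auto
    qed
    have h: "h (x - 1) < h x \<and> T (h (pos_of (\<pi> x - 1))) < T (h x) \<and> h x \<le> n"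
      if x: "x \<in> {1..m}" for x
    proof -
      have xk: "x \<in> {1..k}" using x less.prems(1) by auto
      note iz = ivz[OF is_perm_in[OF perm_pi xk]]
      consider "x < z" | "x = z" | "z < x" by linarith
      then show ?thesis
      proof cases
        case 1
        then have "pos_of (\<pi> x - 1) < z" using iz split(1)[OF xk] by auto
        then show ?thesis using g(4)[of x] 1 x by (auto simp: h_def)
      next
        case 2
        then have "pos_of (\<pi> x - 1) < z" using iz z by auto
        then show ?thesis using c' 2 z g(2,3) pz by (auto simp: h_def supported_def)
      next
        case 3
        then have "\<not> pos_of (\<pi> x - 1) < z" using iz split(2)[OF xk] by auto
        moreover have "p c x \<le> n" using le_n[of z x] last 3 x by auto
        ultimately show ?thesis using gd[of x c] xk 3 last[of x] x
          by (auto simp: h_def good_def supported_def)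
      qed
    qed
    have "h 0 = 0" using g(1) z by (simp add: h_def)
    moreover have "h m = p c m" using z by (simp add: h_def)
    moreover have "h (pos_of m) = p c (pos_of m)"
    proof -
      have "pos_of m \<in> {1..k}" "\<pi> (pos_of m) = m" using pi_pos_of[of m] z less.prems(1) by auto
      then have "\<not> pos_of m < z" using split(1)[of "pos_of m"] z by auto
      then show ?thesis by (simp add: h_def)
    qed
    ultimately show ?thesis using h by blast
  qed
qed

lemma stable_contains:
  assumes "stable p" "p c k \<le> n"
  shows "contains n T k \<pi>"
proof -
  have "x \<le> k \<longleftrightarrow> \<pi> x \<le> k" if "x \<in> {1..k}" for x
    using that is_perm_in[OF perm_pi that] by auto
  then obtain g where "is_position_embedding k \<pi> n T g"
    using stable_prefix[OF assms(1) le_refl assms(2)] position_embeddingI by metis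
  then show ?thesis using contains_iff_position_embedding[OF perm_pi] by blast
qed

text \<open>The chain of the text into which an embedding sends the last fixed point at or before a
  position (\<open>True\<close> for the lower one).\<close>
fun copy_of :: "(nat \<Rightarrow> nat) \<Rightarrow> nat \<Rightarrow> bool" where
  "copy_of g 0 = False"
| "copy_of g (Suc x) =
    (if \<pi> (Suc x) = Suc x then T (g (Suc x)) < g (Suc x) else copy_of g x)"

lemma copy_of_eq:
  assumes "a \<le> b" "\<And>z. z \<in> {a<..b} \<Longrightarrow> \<pi> z \<noteq> z"
  shows "copy_of g b = copy_of g a"
  using assms by (induction rule: dec_induct) auto

lemma copy_of_pred: "x \<in> {1..k} \<Longrightarrow> \<pi> x \<noteq> x \<Longrightarrow> copy_of g x = copy_of g (x - 1)"
  by (cases x) auto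

text \<open>A fixed point splits positions and values at the same place, so none can separate the
  left neighbour of \<open>x\<close> from the lower one. This is what allows
  \<open>supported\<close> to read both in one copy.\<close>

lemma copy_of_below:
  assumes x: "x \<in> {1..k}"
  shows "copy_of g (pos_of (\<pi> x - 1)) = copy_of g (x - 1)"
proof (cases "pos_of (\<pi> x - 1) = 0")
  case True
  then have "\<pi> x - 1 \<notin> {1..k}" using pi_pos_of by force
  then have pix: "\<pi> x = 1" using is_perm_in[OF perm_pi x] by auto
  have "\<pi> z \<noteq> z" if "z \<in> {0<..x - 1}" for z
  proof
    assume "\<pi> z = z"
    then have "z < \<pi> x" using fixed_splits(2)[OF perm_pi avoids_pi _ _ x, of z] that x by auto
    then show False using pix that by auto
  qed
  then show ?thesis using copy_of_eq[of 0 "x - 1" g] True by simp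
next
  case False
  define y where "y = pos_of (\<pi> x - 1)"
  have "\<pi> x - 1 \<in> {1..k}" using False pos_of_outside by metis
  then have y: "y \<in> {1..k}" "\<pi> y = \<pi> x - 1" "0 < \<pi> x"
    using pi_pos_of[of "\<pi> x - 1"] by (auto simp: y_def)
  have split: "a \<in> {1..k} \<Longrightarrow> (a < z \<longrightarrow> \<pi> a < z) \<and> (z < a \<longrightarrow> z < \<pi> a)"
    if "z \<in> {1..k}" "\<pi> z = z" for z a
    using fixed_splits[OF perm_pi avoids_pi that] by blast
  have "x \<noteq> y" using y by auto
  then consider "y \<le> x - 1" | "x < y" by linarith
  then have "copy_of g y = copy_of g (x - 1)"
  proof cases
    case 1
    have "\<pi> z \<noteq> z" if z: "z \<in> {y<..x - 1}" for z
    proof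
      assume "\<pi> z = z"
      moreover have "z \<in> {1..k}" using z x by auto
      ultimately show False using split[of z x] split[of z y] x y z by auto
    qed
    then show ?thesis using copy_of_eq[OF 1, of g] by simp
  next
    case 2
    have nofix: "\<pi> z \<noteq> z" if z: "z \<in> {x - 1<..y}" for z
    proof
      assume f: "\<pi> z = z"
      have zk: "z \<in> {1..k}" using z x y by auto
      show False
        using split[OF zk f x] split[OF zk f y(1)] x y z f 2
        by (cases "z = x"; cases "z = y") auto
    qed
    then show ?thesis using copy_of_eq[of "x - 1" y g] 2 by simp
  qed
  then show ?thesis by (simp add: y_def)
qed

text \<open>An embedding bounds only the copies selected by its own choices at the fixed points;
  pointers of the other copies may run past it.\<close>

definition bounded_by :: "(bool \<Rightarrow> nat \<Rightarrow> nat) \<Rightarrow> (nat \<Rightarrow> nat) \<Rightarrow> bool" where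
  "bounded_by p g \<longleftrightarrow> (\<forall>x\<in>{1..k}. p (copy_of g x) x \<le> g x)"

text \<open>Staying on one chain is what turns a bound on positions into a bound on values.\<close>

definition well_placed :: "(bool \<Rightarrow> nat \<Rightarrow> nat) \<Rightarrow> bool" where
  "well_placed p \<longleftrightarrow> (\<forall>c. p c 0 = 0) \<and>
     (\<forall>c. \<forall>x\<in>{1..k}. p c x = 0 \<or> n < p c x \<or> on_chain (upper c x) (p c x))"

text \<open>A non-fixed pattern point starts or ends an inversion, its image does the same in the
  text, and this determines the chain. For fixed points \<open>copy_of\<close> records the chain by
  definition.\<close>

lemma embedding_on_chain:
  assumes g: "is_position_embedding k \<pi> n T g" and x: "x \<in> {1..k}"
  shows "on_chain (upper (copy_of g x) x) (g x)"
proof -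
  have gin: "g y \<in> {1..n}" if "y \<in> {1..k}" for y
    using g that unfolding is_position_embedding_def by blast
  have mono: "(a < b \<longrightarrow> g a < g b) \<and> (\<pi> a < \<pi> b \<longrightarrow> T (g a) < T (g b))"
    if "a \<in> {1..k}" "b \<in> {1..k}" for a b
    using g that unfolding is_position_embedding_def by blast
  consider "\<pi> x < x" | "\<pi> x = x" | "x < \<pi> x" by linarith
  then show ?thesis
  proof cases
    case 1
    obtain y where y: "y \<in> {1..<x}" "\<pi> x < \<pi> y"
      using larger_before[OF perm_pi x 1] by blast
    have yk: "y \<in> {1..k}" using y x by auto
    have "T (g x) < g x"
      using lower_if_inversion[OF perm_T avoids_T gin[OF yk] gin[OF x]]
        mono[OF yk x] mono[OF x yk] y by auto
    then show ?thesis using 1 by (auto simp: on_chain_def upper_def)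
  next
    case 2
    then show ?thesis using x by (cases x) (auto simp: on_chain_def upper_def)
  next
    case 3
    obtain y where y: "y \<in> {x<..k}" "\<pi> y < \<pi> x"
      using smaller_after[OF perm_pi x 3] by blast
    have yk: "y \<in> {1..k}" using y x by auto
    have "g x \<le> T (g x)"
      using upper_if_inversion[OF perm_T avoids_T gin[OF x] gin[OF yk]]
        mono[OF yk x] mono[OF x yk] y by auto
    then show ?thesis using 3 by (auto simp: on_chain_def upper_def)
  qed
qed

text \<open>A pointer that has reached the image of its position under some embedding never moves again.\<close>
lemma good_at_bound:
  assumes g: "is_position_embedding k \<pi> n T g" and b: "bounded_by p g" and w: "well_placed p"
    and x: "x \<in> {1..k}" and eq: "p (copy_of g x) x = g x"
  shows "good p (copy_of g x) x"
proof -
  have gin: "g y \<in> {1..n}" if "y \<in> {1..k}" for y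
    using g that unfolding is_position_embedding_def by blast
  have mono: "(a < b \<longrightarrow> g a < g b) \<and> (\<pi> a < \<pi> b \<longrightarrow> T (g a) < T (g b))"
    if "a \<in> {1..k}" "b \<in> {1..k}" for a b
    using g that unfolding is_position_embedding_def by blast
  have p0: "p c 0 = 0" for c using w by (simp add: well_placed_def)
  let ?d = "copy_of g (x - 1)"
  have left: "p ?d (x - 1) < g x"
  proof (cases "x = 1")
    case True
    then show ?thesis using p0 gin[OF x] by simp
  next
    case False
    then have "x - 1 \<in> {1..k}" "x - 1 < x" using x by auto
    then show ?thesis
      using b mono[of "x - 1" x] x unfolding bounded_by_def by (meson le_less_trans)
  qed
  let ?y = "pos_of (\<pi> x - 1)"
  have "0 < T (g x)" using is_perm_in[OF perm_T gin[OF x]] by simp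
  have below: "T (p ?d ?y) < T (g x)"
  proof (cases "p ?d ?y = 0")
    case True
    then show ?thesis using \<open>0 < T (g x)\<close> T_0 by simp
  next
    case False
    then have y0: "?y \<noteq> 0" using p0 by metis
    then have "\<pi> x - 1 \<in> {1..k}" using pos_of_outside by metis
    then have y: "?y \<in> {1..k}" "\<pi> ?y < \<pi> x" using pi_pos_of[of "\<pi> x - 1"] by auto
    have "p (copy_of g ?y) ?y \<le> g ?y" using b y(1) unfolding bounded_by_def by blast
    then have le: "p ?d ?y \<le> g ?y" using copy_of_below[OF x, of g] by simp
    have ch: "on_chain (upper ?d ?y) (g ?y)"
      using embedding_on_chain[OF g y(1)] copy_of_below[OF x, of g] by simp
    have "p ?d ?y = 0 \<or> n < p ?d ?y \<or> on_chain (upper ?d ?y) (p ?d ?y)"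
      using w y(1) unfolding well_placed_def by blast
    then have "on_chain (upper ?d ?y) (p ?d ?y)"
      using False le gin[OF y(1)] by auto
    \<comment> \<open>Pointer and image lie on the same chain, so their order by position is also
      their order by value.\<close>
    then have "T (p ?d ?y) \<le> T (g ?y)"
      using chain_mono[OF perm_T avoids_T, of "p ?d ?y" "g ?y"] False le gin[OF y(1)] ch
      by (cases "p ?d ?y = g ?y") (auto simp: on_chain_def)
    also have "\<dots> < T (g x)" using mono[OF y(1) x] y(2) by simp
    finally show ?thesis .
  qed
  have "supported p ?d x (p (copy_of g x) x)"
    using left below eq by (simp add: supported_def)
  then show ?thesis
    using copy_of_pred[OF x, of g] by (cases ?d) (auto simp: good_def)
qed

section \<open>Pointer moves and the search invariant\<close>

definition advances :: "(bool \<Rightarrow> nat \<Rightarrow> nat) \<Rightarrow> bool \<Rightarrow> nat \<Rightarrow> nat \<Rightarrow> bool" where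
  "advances p c x q \<longleftrightarrow> p c x < q \<and> q \<le> n + 1 \<and> (q \<le> n \<longrightarrow> on_chain (upper c x) q) \<and>
     (\<forall>r. p c x < r \<and> r < q \<longrightarrow> \<not> on_chain (upper c x) r)"

definition move :: "(bool \<Rightarrow> nat \<Rightarrow> nat) \<Rightarrow> bool \<Rightarrow> nat \<Rightarrow> nat \<Rightarrow> bool \<Rightarrow> nat \<Rightarrow> nat" where
  "move p c x q = p(c := (p c)(x := q))"

lemma move_apply: "move p c x q c' x' = (if c' = c \<and> x' = x then q else p c' x')"
  by (simp add: move_def)

text \<open>A bad pointer is not yet at the image under \<open>g\<close>, by
  \<open>good_at_bound\<close>. This image lies on the chain that is scanned, so the scan stops
  there at the latest.\<close>

lemma bounded_by_move:
  assumes "is_position_embedding k \<pi> n T g" "bounded_by p g" "well_placed p"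
    and x: "x \<in> {1..k}" and "\<not> good p c x" "advances p c x q"
  shows "bounded_by (move p c x q) g"
proof -
  have "q \<le> g x" if c: "c = copy_of g x"
  proof -
    have "p c x \<noteq> g x" using good_at_bound[OF assms(1-3) x] assms(5) c by auto
    then have "p c x < g x" using assms(2) x c unfolding bounded_by_def by (meson le_neq_implies_less)
    then show ?thesis
      using embedding_on_chain[OF assms(1) x] assms(6) c unfolding advances_def
      by (meson not_le)
  qed
  then show ?thesis using assms(2) by (auto simp: bounded_by_def move_apply)
qed

lemma well_placed_move:
  assumes "well_placed p" "x \<in> {1..k}" "advances p c x q"
  shows "well_placed (move p c x q)"
  using assms by (auto simp: well_placed_def move_apply advances_def)

text \<open>The moved node may still be bad; the others are the right and upper neighbours, whose
  constraints read its pointer. Both copies appear because a fixed neighbour may rely on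
  either.\<close>

definition next_nodes :: "bool \<Rightarrow> nat \<Rightarrow> (bool \<times> nat) list" where
  "next_nodes c x = [(c, x), (False, x + 1), (True, x + 1),
     (False, pos_of (\<pi> x + 1)), (True, pos_of (\<pi> x + 1))]"

lemma good_move:
  assumes "p c' y \<le> n \<longrightarrow> good p c' y" "(c', y) \<notin> set (next_nodes c x)"
    and "x \<in> {1..k}" "y \<in> {1..k}" "move p c x q c' y \<le> n"
  shows "good (move p c x q) c' y"
proof -
  have ne: "\<not> (c' = c \<and> y = x)" "y - 1 \<noteq> x"
    using assms(2,4) by (cases c'; auto simp: next_nodes_def)+
  moreover have "pos_of (\<pi> y - 1) \<noteq> x"
  proof
    assume "pos_of (\<pi> y - 1) = x"
    then have "\<pi> x = \<pi> y - 1" "\<pi> y - 1 \<in> {1..k}"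
      using assms(3) pi_pos_of[of "\<pi> y - 1"] pos_of_outside[of "\<pi> y - 1"] by auto
    then have "\<pi> x + 1 = \<pi> y" by auto
    then have "pos_of (\<pi> x + 1) = y" using pos_of_pi[OF assms(4)] by simp
    then show False using assms(2) by (cases c') (auto simp: next_nodes_def)
  qed
  ultimately show ?thesis
    using assms(1,5) by (auto simp: good_def supported_def move_apply)
qed

text \<open>The list may also contain good nodes and the border positions \<open>0\<close> and
  \<open>k + 1\<close>; it only has to cover the violated ones. An exhausted pointer
  \<open>n + 1\<close> is exempt, as nothing can repair it.\<close>

definition search_inv :: "(bool \<Rightarrow> nat \<Rightarrow> nat) \<Rightarrow> (bool \<times> nat) list \<Rightarrow> bool" where
  "search_inv p S \<longleftrightarrow> well_placed p \<and> (\<forall>c x. p c x \<le> n + 1) \<and>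
     (\<forall>g. is_position_embedding k \<pi> n T g \<longrightarrow> bounded_by p g) \<and>
     (\<forall>c. \<forall>x\<in>{1..k}. p c x \<le> n \<longrightarrow> good p c x \<or> (c, x) \<in> set S)"

lemma search_inv_init:
  assumes "\<And>c x. x \<in> {1..k} \<Longrightarrow> (c, x) \<in> set S"
  shows "search_inv (\<lambda>c x. 0) S"
  using assms by (auto simp: search_inv_def well_placed_def bounded_by_def)

lemma search_inv_drop:
  assumes "search_inv p (S @ [(c, x)])" "x \<in> {1..k} \<and> p c x \<le> n \<longrightarrow> good p c x"
  shows "search_inv p S"
proof -
  have "good p c' y \<or> (c', y) \<in> set S" if "y \<in> {1..k}" "p c' y \<le> n" for c' y
  proof (cases "(c', y) = (c, x)")
    case True
    then show ?thesis using assms(2) that by auto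
  next
    case False
    then have "good p c' y \<or> (c', y) \<in> set (S @ [(c, x)])"
      using assms(1) that unfolding search_inv_def by blast
    then show ?thesis using False by auto
  qed
  then show ?thesis using assms(1) unfolding search_inv_def by blast
qed

lemma search_inv_move:
  assumes "search_inv p (S @ [(c, x)])" "x \<in> {1..k}" "\<not> good p c x" "advances p c x q"
  shows "search_inv (move p c x q) (S @ next_nodes c x)"
  unfolding search_inv_def
proof (intro conjI allI ballI impI)
  show "well_placed (move p c x q)"
    using assms well_placed_move by (simp add: search_inv_def)
  show "move p c x q c' y \<le> n + 1" for c' y
    using assms(1,4) by (simp add: search_inv_def move_apply advances_def)
  show "bounded_by (move p c x q) g" if "is_position_embedding k \<pi> n T g" for g
    using bounded_by_move[OF that] assms that by (simp add: search_inv_def)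
  show "good (move p c x q) c' y \<or> (c', y) \<in> set (S @ next_nodes c x)"
    if "y \<in> {1..k}" "move p c x q c' y \<le> n" for c' y
  proof (cases "(c', y) \<in> set S \<or> (c', y) \<in> set (next_nodes c x)")
    case False
    then have ne: "(c', y) \<notin> set (S @ [(c, x)])" by (auto simp: next_nodes_def)
    then have "p c' y \<le> n \<longrightarrow> good p c' y"
      using assms(1) that(1) ne unfolding search_inv_def by fastforce
    then show ?thesis using good_move False that assms(2) by blast
  qed auto
qed

text \<open>Finiteness at the last position suffices, since in a stable state it passes down to all
  smaller positions in suitable copies. Both copies are inspected because the one selected by an
  embedding is unknown.\<close>

lemma search_inv_result:
  assumes "search_inv p []"
  shows "contains n T k \<pi> \<longleftrightarrow> p False k \<le> n \<or> p True k \<le> n"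
proof
  assume "contains n T k \<pi>"
  then obtain g where g: "is_position_embedding k \<pi> n T g"
    using contains_iff_position_embedding[OF perm_pi] by blast
  show "p False k \<le> n \<or> p True k \<le> n"
  proof (cases "k = 0")
    \<comment> \<open>For the empty pattern the answer is read off the sentinel pointer of position
      \<open>0\<close>.\<close>
    case True
    have "p False 0 = 0" using assms unfolding search_inv_def well_placed_def by blast
    with True show ?thesis by simp
  next
    case False
    then have "k \<in> {1..k}" by simp
    then have "p (copy_of g k) k \<le> g k" "g k \<in> {1..n}"
      using g assms unfolding search_inv_def bounded_by_def is_position_embedding_def by blast+
    then show ?thesis by (cases "copy_of g k") auto
  qed
next
  assume "p False k \<le> n \<or> p True k \<le> n"
  moreover have "stable p" using assms by (simp add: search_inv_def stable_def well_placed_def)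
  ultimately show "contains n T k \<pi>" using stable_contains by blast
qed

section \<open>The potential that pays for pointer moves\<close>

definition slack :: "(bool \<Rightarrow> nat \<Rightarrow> nat) \<Rightarrow> nat" where
  "slack p = (\<Sum>x\<in>{1..k}. (n + 1 - p False x) + (n + 1 - p True x))"

lemma slack_move:
  assumes "x \<in> {1..k}" "advances p c x q"
  shows "slack (move p c x q) + (q - p c x) = slack p"
proof -
  have fin: "finite {1..k}" by simp
  have rest: "(\<Sum>y\<in>{1..k} - {x}. (n + 1 - move p c x q False y) + (n + 1 - move p c x q True y)) =
    (\<Sum>y\<in>{1..k} - {x}. (n + 1 - p False y) + (n + 1 - p True y))"
    by (rule sum.cong) (auto simp: move_apply)
  show ?thesis
    unfolding slack_def sum.remove[OF fin assms(1)] rest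
    using assms(2) by (cases c) (auto simp: move_apply advances_def)
qed

end

section \<open>The program\<close>

text \<open>Registers live at negative addresses, the stack at \<open>- 40\<close> and below. Cells \<open>-11\<close> to \<open>-39\<close>
  are scratch.\<close>

abbreviation (input) one_r :: int where "one_r \<equiv> - 1"
abbreviation (input) zero_r :: int where "zero_r \<equiv> - 2"
abbreviation (input) k_r :: int where "k_r \<equiv> - 3"
abbreviation (input) k1_r :: int where "k1_r \<equiv> - 4"
abbreviation (input) k2_r :: int where "k2_r \<equiv> - 5"
abbreviation (input) n1_r :: int where "n1_r \<equiv> - 6"
abbreviation (input) inv_r :: int where "inv_r \<equiv> - 7"
abbreviation (input) ptr_r :: int where "ptr_r \<equiv> - 8"
abbreviation (input) base_r :: int where "base_r \<equiv> - 9"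
abbreviation (input) sp_r :: int where "sp_r \<equiv> - 10"
abbreviation (input) v_r :: int where "v_r \<equiv> - 11"
abbreviation (input) x_r :: int where "x_r \<equiv> - 12"
abbreviation (input) q_r :: int where "q_r \<equiv> - 13"
abbreviation (input) y_r :: int where "y_r \<equiv> - 14"
abbreviation (input) t_r :: int where "t_r \<equiv> - 15"
abbreviation (input) up_r :: int where "up_r \<equiv> - 16"
abbreviation (input) o1_r :: int where "o1_r \<equiv> - 17"
abbreviation (input) o2_r :: int where "o2_r \<equiv> - 18"
abbreviation (input) a_r :: int where "a_r \<equiv> - 19"
abbreviation (input) b_r :: int where "b_r \<equiv> - 20"
abbreviation (input) off_r :: int where "off_r \<equiv> - 21"
abbreviation (input) main_l :: nat where "main_l \<equiv> 5"
abbreviation (input) init_l :: nat where "init_l \<equiv> 13"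
abbreviation (input) loop_l :: nat where "loop_l \<equiv> 25"
abbreviation (input) node_l :: nat where "node_l \<equiv> 33"
abbreviation (input) not_above_l :: nat where "not_above_l \<equiv> 47"
abbreviation (input) fixed_l :: nat where "fixed_l \<equiv> 50"
abbreviation (input) check_l :: nat where "check_l \<equiv> 54"
abbreviation (input) fail_l :: nat where "fail_l \<equiv> 69"
abbreviation (input) scan_l :: nat where "scan_l \<equiv> 72"
abbreviation (input) upper_l :: nat where "upper_l \<equiv> 79"
abbreviation (input) store_l :: nat where "store_l \<equiv> 80"
abbreviation (input) finish_l :: nat where "finish_l \<equiv> 99"
abbreviation (input) yes_l :: nat where "yes_l \<equiv> 107"
abbreviation (input) end_l :: nat where "end_l \<equiv> 108"

text \<open>In \<open>Add\<close> and \<open>JumpLE\<close> the operands \<open>0\<close> and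
  \<open>1\<close> are cells. Cell \<open>0\<close> holds \<open>n\<close> and finally the answer.
  Cell \<open>1\<close> holds \<open>k\<close>, is copied to \<open>k_r\<close> and then cleared,
  because it serves as the text value at position \<open>0\<close>. As \<open>zero_r\<close> keeps
  its initial zero, \<open>JumpLE zero_r zero_r\<close> always jumps. A node is a single number,
  which also indexes its pointer.\<close>

definition prog :: "instr list" where
  "prog = [
    LoadC one_r 1, Add k_r 1 zero_r, JumpLE k_r 0 main_l, LoadC 0 0, JumpLE zero_r zero_r end_l,

    LoadC 1 0, Add n1_r 0 one_r, Add k1_r k_r one_r, Add k2_r k1_r one_r, Add inv_r n1_r k2_r,
    Add ptr_r inv_r k2_r, LoadC base_r (- 40), LoadC sp_r (- 40),

    JumpLE k_r x_r loop_l, Add x_r x_r one_r, Add a_r n1_r x_r, LoadI y_r a_r,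
    Add a_r inv_r y_r, StoreI a_r x_r, StoreI sp_r x_r, Sub sp_r sp_r one_r, Add v_r x_r k2_r,
    StoreI sp_r v_r, Sub sp_r sp_r one_r, JumpLE zero_r zero_r init_l,

    JumpLE base_r sp_r finish_l, Add sp_r sp_r one_r, LoadI v_r sp_r, Add x_r v_r zero_r,
    LoadC off_r 0, JumpLE v_r k1_r node_l, Sub x_r v_r k2_r, Add off_r k2_r zero_r,

    JumpLE x_r zero_r loop_l, JumpLE k1_r x_r loop_l, Add a_r ptr_r v_r, LoadI q_r a_r,
    JumpLE n1_r q_r loop_l, Add a_r n1_r x_r, LoadI y_r a_r, Add a_r q_r one_r, LoadI t_r a_r,
    Add o1_r off_r zero_r, Add o2_r off_r zero_r, LoadC up_r 1, JumpLE y_r x_r not_above_l,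
    JumpLE zero_r zero_r check_l,

    LoadC up_r 0, JumpLE x_r y_r fixed_l, JumpLE zero_r zero_r check_l,

    LoadC o1_r 0, Add o2_r k2_r zero_r, JumpLE k2_r off_r check_l, LoadC up_r 1,

    Add a_r ptr_r o1_r, Add a_r a_r x_r, Sub a_r a_r one_r, LoadI b_r a_r,
    JumpLE q_r b_r fail_l, Sub a_r y_r one_r, Add a_r a_r inv_r, LoadI a_r a_r,
    Add a_r a_r o1_r, Add a_r a_r ptr_r, LoadI a_r a_r, Add a_r a_r one_r, LoadI a_r a_r,
    JumpLE t_r a_r fail_l, JumpLE zero_r zero_r loop_l,

    JumpLE o2_r o1_r scan_l, Add o1_r o2_r zero_r, JumpLE zero_r zero_r check_l,

    Add q_r q_r one_r, JumpLE n1_r q_r store_l, Add a_r q_r one_r, LoadI t_r a_r,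
    JumpLE q_r t_r upper_l, JumpLE up_r zero_r store_l, JumpLE zero_r zero_r scan_l,

    JumpLE up_r zero_r scan_l,

    Add a_r ptr_r v_r, StoreI a_r q_r, StoreI sp_r v_r, Sub sp_r sp_r one_r, Add b_r x_r one_r,
    StoreI sp_r b_r, Sub sp_r sp_r one_r, Add b_r b_r k2_r, StoreI sp_r b_r,
    Sub sp_r sp_r one_r, Add a_r y_r one_r, Add a_r a_r inv_r, LoadI b_r a_r, StoreI sp_r b_r,
    Sub sp_r sp_r one_r, Add b_r b_r k2_r, StoreI sp_r b_r, Sub sp_r sp_r one_r,
    JumpLE zero_r zero_r loop_l,

    Add a_r ptr_r k_r, LoadI b_r a_r, JumpLE b_r 0 yes_l, Add a_r a_r k2_r, LoadI b_r a_r,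
    JumpLE b_r 0 yes_l, LoadC 0 0, JumpLE zero_r zero_r end_l,

    LoadC 0 1]"

text \<open>Unfolding \<open>listed 0 prog\<close> yields one rewrite rule for each instruction.\<close>
primrec listed :: "nat \<Rightarrow> instr list \<Rightarrow> bool" where
  "listed i [] = True"
| "listed i (x # xs) = (prog ! i = x \<and> listed (i + 1) xs)"

lemma listed_drop: "xs = drop i prog \<Longrightarrow> listed i xs"
proof (induction xs arbitrary: i)
  case (Cons x xs)
  then have "i < length prog" by (metis drop_all list.distinct(1) not_le)
  then have "drop i prog = prog ! i # drop (Suc i) prog" by (simp add: Cons_nth_drop_Suc)
  with Cons show ?case by simp
qed simp

lemma listed_prog: "listed 0 prog"
  by (rule listed_drop) simp

lemmas prog_nth = listed_prog[unfolded prog_def, unfolded listed.simps,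
  unfolded add_0 one_add_one numeral_plus_one add_num_simps]

lemma length_prog: "length prog = 108"
  by (simp add: prog_def)


lemma step_prog: "step prog (pc, m) = (if pc < 108 then exec_instr (prog ! pc) (pc, m) else (pc, m))"
  by (simp add: step_def halted_def length_prog)

lemma run_Suc: "(step prog ^^ Suc t) c = (step prog ^^ t) (step prog c)"
  by (simp add: funpow_swap1)

lemma run_numeral:
  "(step prog ^^ numeral t) c = (step prog ^^ pred_numeral t) (step prog c)"
  unfolding numeral_eq_Suc run_Suc ..

lemma run_1: "(step prog ^^ 1) c = step prog c"
  by simp

lemmas sim = step_prog prog_nth run_numeral run_Suc run_1




text \<open>An upper bound in place of an exact step count lets branches of different lengths meet
  in one statement.\<close>

definition reach :: "nat \<Rightarrow> config \<Rightarrow> config \<Rightarrow> bool" where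
  "reach t c c' \<longleftrightarrow> (\<exists>s\<le>t. (step prog ^^ s) c = c')"

lemma reachI: "(step prog ^^ s) c = c' \<Longrightarrow> s \<le> t \<Longrightarrow> reach t c c'"
  by (auto simp: reach_def)

lemma reach_trans: "reach s a b \<Longrightarrow> reach t b c \<Longrightarrow> reach (s + t) a c"
proof -
  assume "reach s a b" "reach t b c"
  then obtain i j where "i \<le> s" "j \<le> t" "(step prog ^^ i) a = b" "(step prog ^^ j) b = c"
    unfolding reach_def by blast
  then show ?thesis
    by (intro reachI[of "j + i"]) (simp_all add: funpow_add)
qed

lemma reach_mono: "reach s a b \<Longrightarrow> s \<le> t \<Longrightarrow> reach t a b"
  unfolding reach_def using le_trans by blast

section \<open>Symbolic execution of the program blocks\<close>

lemma run_reject: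
  assumes "m zero_r = 0" "m 0 < m 1"
  shows "reach 5 (0, m) (end_l, m(one_r := 1, k_r := m 1, 0 := 0))"
  by (rule reachI[of 5]) (use assms in \<open>simp_all add: sim del: One_nat_def\<close>)

lemma run_start:
  assumes "m zero_r = 0" "m 1 \<le> m 0"
  shows "reach 11 (0, m) (init_l, m(one_r := 1, k_r := m 1, 1 := 0, n1_r := m 0 + 1,
    k1_r := m 1 + 1, k2_r := m 1 + 2, inv_r := m 0 + m 1 + 3, ptr_r := m 0 + 2 * m 1 + 5,
    base_r := - 40, sp_r := - 40))"
  by (rule reachI[of 11]) (use assms in \<open>simp_all add: sim algebra_simps del: One_nat_def\<close>)

lemma run_push:
  assumes "prog ! pc = StoreI sp_r r" "prog ! (pc + 1) = Sub sp_r sp_r one_r" "pc + 1 < 108"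
    and "m sp_r \<le> - 40" "m one_r = 1"
  shows "reach 2 (pc, m) (pc + 2, m(m sp_r := m r, sp_r := m sp_r - 1))"
proof (rule reachI[of 2])
  have "prog ! Suc pc = Sub sp_r sp_r one_r" using assms(2) by simp
  then show "(step prog ^^ 2) (pc, m) = (pc + 2, m(m sp_r := m r, sp_r := m sp_r - 1))"
    using assms(1,3-) by (simp add: step_prog run_numeral run_Suc)
qed simp

lemma run_init_done:
  assumes "m k_r \<le> m x_r"
  shows "reach 1 (init_l, m) (loop_l, m)"
  by (rule reachI[of 1]) (use assms in \<open>simp_all add: sim\<close>)

lemma run_init:
  assumes "m x_r < m k_r" "m one_r = 1" "0 \<le> m n1_r + (m x_r + 1)" "m (m n1_r + (m x_r + 1)) = y"
    and "0 \<le> m inv_r + y"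
  shows "reach 6 (init_l, m)
    (19, m(x_r := m x_r + 1, y_r := y, a_r := m inv_r + y, m inv_r + y := m x_r + 1))"
  by (rule reachI[of 6]) (use assms in \<open>simp_all add: sim\<close>)

lemma run_add_v:
  "reach 1 (21, m) (22, m(v_r := m x_r + m k2_r))"
  by (rule reachI[of 1]) (simp_all add: sim)

lemma run_jump_init:
  "reach 1 (24, m) (init_l, m)"
  by (rule reachI[of 1]) (simp_all add: sim)

lemma run_empty:
  assumes "m base_r \<le> m sp_r"
  shows "reach 1 (loop_l, m) (finish_l, m)"
  by (rule reachI[of 1]) (use assms in \<open>simp_all add: sim\<close>)

lemma run_pop:
  assumes "m sp_r < m base_r" "m base_r = - 40" "m zero_r = 0" "m one_r = 1"
    and "m (m sp_r + 1) = v"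
  shows "reach 8 (loop_l, m) (node_l, m(sp_r := m sp_r + 1, v_r := v,
    x_r := (if v \<le> m k1_r then v else v - m k2_r), off_r := (if v \<le> m k1_r then 0 else m k2_r)))"
proof (cases "v \<le> m k1_r")
  case True
  show ?thesis
    by (rule reachI[of 6]) (use assms True in \<open>simp_all add: sim\<close>)
next
  case False
  show ?thesis
    by (rule reachI[of 8]) (use assms False in \<open>simp_all add: sim\<close>)
qed

lemma run_skip:
  assumes "m zero_r = 0" "0 \<le> m ptr_r + m v_r" "m x_r \<le> 0 \<or> m k1_r \<le> m x_r \<or> m n1_r \<le> m (m ptr_r + m v_r)"
  shows "\<exists>a b. reach 5 (node_l, m) (loop_l, m(a_r := a, q_r := b))"
proof -
  consider "m x_r \<le> 0" | "\<not> m x_r \<le> 0" "m k1_r \<le> m x_r"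
    | "\<not> m x_r \<le> 0" "\<not> m k1_r \<le> m x_r" "m n1_r \<le> m (m ptr_r + m v_r)"
    using assms(3) by blast
  then show ?thesis
  proof cases
    case 1
    have "reach 5 (node_l, m) (loop_l, m(a_r := m a_r, q_r := m q_r))"
      by (rule reachI[of 1]) (use assms 1 in \<open>simp_all add: sim\<close>)
    then show ?thesis by blast
  next
    case 2
    have "reach 5 (node_l, m) (loop_l, m(a_r := m a_r, q_r := m q_r))"
      by (rule reachI[of 2]) (use assms 2 in \<open>simp_all add: sim\<close>)
    then show ?thesis by blast
  next
    case 3
    have "reach 5 (node_l, m) (loop_l, m(a_r := m ptr_r + m v_r, q_r := m (m ptr_r + m v_r)))"
      by (rule reachI[of 5]) (use assms 3 in \<open>simp_all add: sim\<close>)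
    then show ?thesis by blast
  qed
qed

lemma run_node:
  assumes "m zero_r = 0" "m one_r = 1" "0 < m x_r" "m x_r < m k1_r"
    and "0 \<le> m ptr_r + m v_r" "m (m ptr_r + m v_r) = q" "q < m n1_r"
    and "0 \<le> m n1_r + m x_r" "m (m n1_r + m x_r) = y"
    and "0 \<le> q + 1" "m (q + 1) = t"
  shows "reach 19 (node_l, m) (check_l, m(q_r := q, y_r := y, a_r := q + 1, t_r := t,
    o1_r := (if m x_r = y then 0 else m off_r), o2_r := (if m x_r = y then m k2_r else m off_r),
    up_r := (if m x_r < y \<or> m x_r = y \<and> m off_r < m k2_r then 1 else 0)))"
proof -
  consider "m x_r < y" | "y < m x_r" | "m x_r = y" "m off_r < m k2_r" | "m x_r = y" "m k2_r \<le> m off_r"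
    by linarith
  then show ?thesis
  proof cases
    case 1
    show ?thesis by (rule reachI[of 14]) (use assms 1 in \<open>simp_all add: sim\<close>)
  next
    case 2
    show ?thesis by (rule reachI[of 16]) (use assms 2 in \<open>simp_all add: sim\<close>)
  next
    case 3
    show ?thesis by (rule reachI[of 19]) (use assms 3 in \<open>simp_all add: sim\<close>)
  next
    case 4
    show ?thesis
      by (rule reachI[of 18])
        (use assms 4 in \<open>simp_all add: sim fun_upd_twist[of up_r o1_r] fun_upd_twist[of up_r o2_r]\<close>)
  qed
qed

lemma run_check:
  assumes "0 \<le> m ptr_r + m o1_r + m x_r - m one_r" "m (m ptr_r + m o1_r + m x_r - m one_r) = l"
    and "0 \<le> m y_r - m one_r + m inv_r" "m (m y_r - m one_r + m inv_r) = j"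
    and "0 \<le> j + m o1_r + m ptr_r" "m (j + m o1_r + m ptr_r) = b"
    and "0 \<le> b + m one_r" "m (b + m one_r) = s"
  shows "\<exists>a. reach 15 (check_l, m)
    (if l < m q_r \<and> s < m t_r then loop_l else fail_l, m(b_r := l, a_r := a))"
proof -
  consider "m q_r \<le> l" | "\<not> m q_r \<le> l" "m t_r \<le> s" | "\<not> m q_r \<le> l" "\<not> m t_r \<le> s" by blast
  then show ?thesis
  proof cases
    case 1
    have "reach 15 (check_l, m) (fail_l, m(b_r := l, a_r := m ptr_r + m o1_r + m x_r - m one_r))"
      by (rule reachI[of 5]) (use assms 1 in \<open>simp_all add: sim fun_upd_twist[of a_r b_r]\<close>)
    with 1 show ?thesis by auto
  next
    case 2
    have "reach 15 (check_l, m) (fail_l, m(b_r := l, a_r := s))"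
      by (rule reachI[of 14]) (use assms 2 in \<open>simp_all add: sim\<close>)
    with 2 show ?thesis by auto
  next
    case 3
    have "reach 15 (check_l, m) (loop_l, m(b_r := l, a_r := s))"
      by (rule reachI[of 15]) (use assms 3 in \<open>simp_all add: sim\<close>)
    with 3 show ?thesis by auto
  qed
qed

lemma run_fail:
  "m zero_r = 0 \<Longrightarrow>
    reach 3 (fail_l, m) (if m o2_r \<le> m o1_r then (scan_l, m) else (check_l, m(o1_r := m o2_r)))"
  by (cases "m o2_r \<le> m o1_r"; rule reachI[of "if m o2_r \<le> m o1_r then 1 else 3"])
    (simp_all add: sim)

lemma run_scan:
  assumes "m zero_r = 0" "m one_r = 1" "0 \<le> m q_r" "m up_r = (if u then 1 else 0)"
    and "m (2 + m q_r) = t"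
  shows "\<exists>a b. reach 7 (scan_l, m)
    (if m n1_r \<le> m q_r + 1 \<or> (u \<longleftrightarrow> m q_r + 1 \<le> t) then store_l else scan_l,
     m(q_r := m q_r + 1, a_r := a, t_r := b))"
proof (cases "m n1_r \<le> m q_r + 1")
  case True
  have "reach 7 (scan_l, m) (store_l, m(q_r := m q_r + 1, a_r := m a_r, t_r := m t_r))"
    by (rule reachI[of 2]) (use assms True in \<open>simp_all add: sim fun_upd_idem\<close>)
  then show ?thesis using True by auto
next
  case False
  have "reach 7 (scan_l, m) (if u \<longleftrightarrow> m q_r + 1 \<le> t then store_l else scan_l,
     m(q_r := m q_r + 1, a_r := 2 + m q_r, t_r := t))"
  proof (cases "u \<or> m q_r + 1 \<le> t")
    case True
    show ?thesis
    proof (cases "u \<and> \<not> m q_r + 1 \<le> t")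
      case True
      then show ?thesis
        by (intro reachI[of 7]) (use assms False in \<open>simp_all add: sim\<close>)
    next
      case nt: False
      then show ?thesis using True
        by (intro reachI[of 6]) (use assms False in \<open>auto simp: sim\<close>)
    qed
  next
    case nt: False
    then show ?thesis
      by (intro reachI[of 6]) (use assms False in \<open>simp_all add: sim\<close>)
  qed
  with False show ?thesis by (intro exI[of _ "2 + m q_r"] exI[of _ t]) simp
qed

lemma run_store:
  assumes "0 \<le> m ptr_r + m v_r"
  shows "reach 2 (store_l, m) (82, m(a_r := m ptr_r + m v_r, m ptr_r + m v_r := m q_r))"
  by (rule reachI[of 2]) (use assms in \<open>simp_all add: sim\<close>)

lemma run_right: "reach 1 (84, m) (85, m(b_r := m x_r + m one_r))"
  by (rule reachI[of 1]) (simp_all add: sim)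

lemma run_copy: "reach 1 (87, m) (88, m(b_r := m b_r + m k2_r))" "reach 1 (95, m) (96, m(b_r := m b_r + m k2_r))"
  by (rule reachI[of 1]; simp add: sim)+

lemma run_above:
  assumes "0 \<le> m y_r + m one_r + m inv_r" "m (m y_r + m one_r + m inv_r) = z"
  shows "reach 3 (90, m) (93, m(a_r := m y_r + m one_r + m inv_r, b_r := z))"
  by (rule reachI[of 3]) (use assms in \<open>simp_all add: sim\<close>)

lemma run_jump_loop: "reach 1 (98, m) (loop_l, m)"
  by (rule reachI[of 1]) (simp_all add: sim)

lemma run_finish:
  assumes "0 \<le> m ptr_r + m k_r" "0 \<le> m ptr_r + m k_r + m k2_r"
  shows "\<exists>m'. reach 8 (finish_l, m) (end_l, m') \<and>
    m' 0 = (if m (m ptr_r + m k_r) \<le> m 0 \<or> m (m ptr_r + m k_r + m k2_r) \<le> m 0 then 1 else 0)"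
proof -
  have ex: "\<exists>m'. reach 8 c (l, m') \<and> P m'" if "\<exists>m'. (step prog ^^ s) c = (l, m') \<and> P m'" "s \<le> 8"
    for c l P s
    using that by (auto intro: reachI)
  consider "m (m ptr_r + m k_r) \<le> m 0"
    | "\<not> m (m ptr_r + m k_r) \<le> m 0" "m (m ptr_r + m k_r + m k2_r) \<le> m 0"
    | "\<not> m (m ptr_r + m k_r) \<le> m 0" "\<not> m (m ptr_r + m k_r + m k2_r) \<le> m 0"
    by blast
  then show ?thesis
  proof cases
    case 1
    show ?thesis by (rule ex[of 4]) (use assms 1 in \<open>simp_all add: sim\<close>)
  next
    case 2
    show ?thesis by (rule ex[of 7]) (use assms 2 in \<open>simp_all add: sim\<close>)
  next
    case 3
    show ?thesis by (rule ex[of 8]) (use assms 3 in \<open>simp_all add: sim\<close>)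
  qed
qed

section \<open>The program implements the search\<close>

text \<open>\<open>T\<close> describes the input block of the memory: the text followed by the pattern. A pointer \<open>n + 1\<close>
  thus makes the program read a pattern entry as if it were a text value; this is harmless, as in
  a stable state a position is impossible once its left neighbour is, in every copy that could
  support it.\<close>
locale matching_machine = matching +
  assumes T_pi: "\<And>x. x \<in> {1..k} \<Longrightarrow> T (n + x) = \<pi> x"
begin

text \<open>The stride \<open>k + 2\<close> leaves room in each copy for the border positions
  \<open>0\<close> and \<open>k + 1\<close>, which get pushed as neighbours of extreme
  points.\<close>

definition node :: "bool \<Rightarrow> nat \<Rightarrow> int" where
  "node c x = int x + (if c then int k + 2 else 0)"

lemma node_eq_iff: "x \<le> k + 1 \<Longrightarrow> x' \<le> k + 1 \<Longrightarrow> node c x = node c' x' \<longleftrightarrow> c = c' \<and> x = x'"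
  by (auto simp: node_def)

lemma node_nonneg: "0 \<le> node c x"
  by (simp add: node_def)

text \<open>The input block starts at cell \<open>1\<close>, the sentinel for position
  \<open>0\<close>, and ends with the pattern. The inverse table is a parameter \<open>w\<close>
  because it is filled gradually during set-up. The last element of \<open>S\<close> is the top of
  the stack, which grows downwards.\<close>

definition represents ::
  "(int \<Rightarrow> int) \<Rightarrow> (nat \<Rightarrow> nat) \<Rightarrow> (bool \<Rightarrow> nat \<Rightarrow> nat) \<Rightarrow> (bool \<times> nat) list \<Rightarrow> bool" where
  "represents m w p S \<longleftrightarrow>
     m 0 = int n \<and> m one_r = 1 \<and> m zero_r = 0 \<and> m k_r = int k \<and> m k1_r = int k + 1 \<and>
     m k2_r = int k + 2 \<and> m n1_r = int n + 1 \<and> m inv_r = int n + int k + 3 \<and>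
     m ptr_r = int n + 2 * int k + 5 \<and> m base_r = - 40 \<and> m sp_r = - 40 - int (length S) \<and>
     (\<forall>i\<le>n + k. m (int i + 1) = int (T i)) \<and>
     (\<forall>y\<le>k + 1. m (int n + int k + 3 + int y) = int (w y)) \<and>
     (\<forall>c. \<forall>x\<le>k + 1. m (int n + 2 * int k + 5 + node c x) = int (p c x)) \<and>
     (\<forall>i<length S. m (- 40 - int i) = case_prod node (S ! i) \<and> snd (S ! i) \<le> k + 1)"

lemma represents_regs:
  assumes "represents m w p S"
  shows "m 0 = int n" "m one_r = 1" "m zero_r = 0" "m k_r = int k" "m k1_r = int k + 1"
    "m k2_r = int k + 2" "m n1_r = int n + 1" "m inv_r = int n + int k + 3"
    "m ptr_r = int n + 2 * int k + 5" "m base_r = - 40" "m sp_r = - 40 - int (length S)"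
  using assms unfolding represents_def by blast+

lemma represents_input: "represents m w p S \<Longrightarrow> i \<le> n + k \<Longrightarrow> a = int i + 1 \<Longrightarrow> m a = int (T i)"
  unfolding represents_def by blast

lemma represents_inv:
  "represents m w p S \<Longrightarrow> y \<le> k + 1 \<Longrightarrow> a = int n + int k + 3 + int y \<Longrightarrow> m a = int (w y)"
  unfolding represents_def by blast

lemma represents_ptr:
  "represents m w p S \<Longrightarrow> x \<le> k + 1 \<Longrightarrow> a = int n + 2 * int k + 5 + node c x \<Longrightarrow> m a = int (p c x)"
  unfolding represents_def by blast

lemma represents_stack:
  "represents m w p S \<Longrightarrow> i < length S \<Longrightarrow>
    m (- 40 - int i) = case_prod node (S ! i) \<and> snd (S ! i) \<le> k + 1"
  unfolding represents_def by blast

section \<open>Memory updates and the represented state\<close>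

lemma represents_scratch:
  assumes "represents m w p S" "- 39 \<le> a" "a \<le> - 11"
  shows "represents (m(a := v)) w p S"
  unfolding represents_def
proof (intro conjI allI impI)
  show "(m(a := v)) (int n + 2 * int k + 5 + node c x) = int (p c x)" if "x \<le> k + 1" for c x
    using represents_ptr[OF assms(1) that refl, of c] assms(3) node_nonneg[of c x] by simp
  show "(m(a := v)) (int i + 1) = int (T i)" if "i \<le> n + k" for i
    using represents_input[OF assms(1) that refl] assms(3) by simp
  show "(m(a := v)) (int n + int k + 3 + int y) = int (w y)" if "y \<le> k + 1" for y
    using represents_inv[OF assms(1) that refl] assms(3) by simp
  show "(m(a := v)) (- 40 - int i) = case_prod node (S ! i)" "snd (S ! i) \<le> k + 1"
    if "i < length S" for i
    using represents_stack[OF assms(1) that] assms(2) by simp_all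
qed (use assms(2,3) represents_regs[OF assms(1)] in simp_all)

lemma represents_push:
  assumes "represents m w p S" "x \<le> k + 1"
  shows "represents (m(m sp_r := node c x, sp_r := m sp_r - 1)) w p (S @ [(c, x)])"
proof -
  note regs = represents_regs[OF assms(1)]
  show ?thesis
    unfolding represents_def
  proof (intro conjI allI impI)
    show "(m(m sp_r := node c x, sp_r := m sp_r - 1)) (int n + 2 * int k + 5 + node d y) = int (p d y)"
      if "y \<le> k + 1" for d y
      using represents_ptr[OF assms(1) that refl, of d] regs(11) node_nonneg[of d y] by simp
  qed (use assms(2) regs represents_input[OF assms(1)] represents_inv[OF assms(1)]
        represents_stack[OF assms(1)] in \<open>auto simp: nth_append less_Suc_eq\<close>)
qed

lemma represents_pop:
  assumes "represents m w p (S @ [(c, x)])"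
  shows "represents (m(sp_r := m sp_r + 1)) w p S" "m (m sp_r + 1) = node c x" "x \<le> k + 1"
proof -
  note regs = represents_regs[OF assms]
  have stack: "m (- 40 - int i) = case_prod node (S ! i) \<and> snd (S ! i) \<le> k + 1"
    if "i < length S" for i
    using represents_stack[OF assms, of i] that by (simp add: nth_append)
  show "represents (m(sp_r := m sp_r + 1)) w p S"
    unfolding represents_def
  proof (intro conjI allI impI)
    show "(m(sp_r := m sp_r + 1)) (int n + 2 * int k + 5 + node d y) = int (p d y)"
      if "y \<le> k + 1" for d y
      using represents_ptr[OF assms that refl, of d] node_nonneg[of d y] by simp
  qed (use regs represents_input[OF assms] represents_inv[OF assms] stack in auto)
  show "m (m sp_r + 1) = node c x" "x \<le> k + 1"
    using represents_stack[OF assms, of "length S"] regs(11) by simp_all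
qed

lemma represents_set_inv:
  assumes "represents m w p S" "y \<le> k + 1"
  shows "represents (m(m inv_r + int y := int j)) (w(y := j)) p S"
proof -
  note regs = represents_regs[OF assms(1)]
  show ?thesis
    unfolding represents_def
  proof (intro conjI allI impI)
    show "(m(m inv_r + int y := int j)) (int n + 2 * int k + 5 + node d x) = int (p d x)"
      if "x \<le> k + 1" for d x
      using represents_ptr[OF assms(1) that refl, of d] assms(2) regs(8) node_nonneg[of d x] by simp
    show "(m(m inv_r + int y := int j)) (int i + 1) = int (T i)" if "i \<le> n + k" for i
      using represents_input[OF assms(1) that refl] that regs(8) by simp
    show "(m(m inv_r + int y := int j)) (int n + int k + 3 + int x) = int ((w(y := j)) x)"
      if "x \<le> k + 1" for x
      using represents_inv[OF assms(1) that refl] regs(8) by simp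
    show "(m(m inv_r + int y := int j)) (- 40 - int i) = case_prod node (S ! i)"
      "snd (S ! i) \<le> k + 1" if "i < length S" for i
      using represents_stack[OF assms(1) that] regs(8) by simp_all
  qed (use regs in simp_all)
qed

lemma represents_set_ptr:
  assumes "represents m w p S" "x \<le> k + 1"
  shows "represents (m(m ptr_r + node c x := int q)) w (move p c x q) S"
proof -
  note regs = represents_regs[OF assms(1)]
  show ?thesis
    unfolding represents_def
  proof (intro conjI allI impI)
    show "(m(m ptr_r + node c x := int q)) (int n + 2 * int k + 5 + node d y) = int (move p c x q d y)"
      if "y \<le> k + 1" for d y
      using represents_ptr[OF assms(1) that refl, of d] node_eq_iff[OF that assms(2), of d c] regs(9)
      by (simp add: move_apply)
    show "(m(m ptr_r + node c x := int q)) (int i + 1) = int (T i)" if "i \<le> n + k" for i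
      using represents_input[OF assms(1) that refl] that regs(9) node_nonneg[of c x] by simp
    show "(m(m ptr_r + node c x := int q)) (int n + int k + 3 + int y) = int (w y)"
      if "y \<le> k + 1" for y
      using represents_inv[OF assms(1) that refl] that regs(9) node_nonneg[of c x] by simp
    show "(m(m ptr_r + node c x := int q)) (- 40 - int i) = case_prod node (S ! i)"
      "snd (S ! i) \<le> k + 1" if "i < length S" for i
      using represents_stack[OF assms(1) that] regs(9) node_nonneg[of c x] by simp_all
  qed (use regs node_nonneg[of c x] in simp_all)
qed

lemma reach_push:
  assumes "represents m w p S" "prog ! pc = StoreI sp_r r" "prog ! (pc + 1) = Sub sp_r sp_r one_r"
    and "pc + 1 < 108" "m r = node c x" "x \<le> k + 1"
  shows "\<exists>m'. reach 2 (pc, m) (pc + 2, m') \<and> represents m' w p (S @ [(c, x)]) \<and>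
    (\<forall>a\<in>{- 39..- 11}. m' a = m a)"
proof -
  let ?m = "m(m sp_r := node c x, sp_r := m sp_r - 1)"
  note regs = represents_regs[OF assms(1)]
  have "reach 2 (pc, m) (pc + 2, ?m)"
    using run_push[of pc r m, OF assms(2-4)] regs assms(5) by simp
  moreover have "\<forall>a\<in>{- 39..- 11}. ?m a = m a" using regs(11) by auto
  ultimately show ?thesis using represents_push[OF assms(1,6), of c] by blast
qed

section \<open>Set-up: inverse pattern and initial work list\<close>

definition partial_inv :: "nat \<Rightarrow> nat \<Rightarrow> nat" where
  "partial_inv j y = (if pos_of y \<le> j then pos_of y else 0)"

lemma partial_inv_0: "partial_inv 0 = (\<lambda>y. 0)"
  by (auto simp: partial_inv_def)

lemma partial_inv_k: "partial_inv k = pos_of"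
  using pos_of_le by (auto simp: partial_inv_def)

lemma partial_inv_Suc:
  assumes "Suc j \<le> k"
  shows "(partial_inv j)(\<pi> (Suc j) := Suc j) = partial_inv (Suc j)"
proof
  have j: "Suc j \<in> {1..k}" using assms by simp
  fix y
  have "y = \<pi> (Suc j)" if "pos_of y = Suc j"
    using that pi_pos_of[of y] pos_of_outside[of y] by (cases "y \<in> {1..k}") auto
  then consider "y = \<pi> (Suc j)" "pos_of y = Suc j" | "y \<noteq> \<pi> (Suc j)" "pos_of y \<noteq> Suc j"
    using pos_of_pi[OF j] by blast
  then show "((partial_inv j)(\<pi> (Suc j) := Suc j)) y = partial_inv (Suc j) y"
    by cases (simp_all add: partial_inv_def le_Suc_eq)
qed

fun all_nodes :: "nat \<Rightarrow> (bool \<times> nat) list" where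
  "all_nodes 0 = []"
| "all_nodes (Suc j) = all_nodes j @ [(False, Suc j), (True, Suc j)]"

lemma length_all_nodes: "length (all_nodes j) = 2 * j"
  by (induction j) auto

lemma set_all_nodes: "x \<in> {1..j} \<Longrightarrow> (c, x) \<in> set (all_nodes j)"
proof (induction j)
  case (Suc j)
  then show ?case by (cases "x = Suc j"; cases c) auto
qed simp

lemma reach_init_step:
  assumes rep: "represents m (partial_inv j) p S" and x: "m x_r = int j" and j: "Suc j \<le> k"
  shows "\<exists>m'. reach 12 (init_l, m) (init_l, m') \<and> m' x_r = int (Suc j) \<and>
    represents m' (partial_inv (Suc j)) p (S @ [(False, Suc j), (True, Suc j)])"
proof -
  note regs = represents_regs[OF rep]
  have jk: "Suc j \<in> {1..k}" using j by simp
  have pi_in: "\<pi> (Suc j) \<in> {1..k}" using is_perm_in[OF perm_pi jk] .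
  have y: "m (m n1_r + (m x_r + 1)) = int (\<pi> (Suc j))"
    using represents_input[OF rep, of "n + Suc j" "m n1_r + (m x_r + 1)"] T_pi[OF jk] j regs x
    by simp
  define m1 where "m1 = m(x_r := m x_r + 1, y_r := int (\<pi> (Suc j)),
    a_r := m inv_r + int (\<pi> (Suc j)), m inv_r + int (\<pi> (Suc j)) := m x_r + 1)"
  have r1: "reach 6 (init_l, m) (19, m1)"
    unfolding m1_def by (rule run_init) (use regs x j y in simp_all)
  have "represents (m(x_r := m x_r + 1, y_r := int (\<pi> (Suc j)), a_r := m inv_r + int (\<pi> (Suc j))))
    (partial_inv j) p S"
    by (intro represents_scratch rep) simp_all
  from represents_set_inv[OF this, of "\<pi> (Suc j)" "Suc j"] pi_in
  have rep1: "represents m1 (partial_inv (Suc j)) p S"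
    unfolding m1_def partial_inv_Suc[OF j, symmetric] using x by (simp add: add.commute)
  have x1: "m1 x_r = node False (Suc j)"
    using regs x by (simp add: m1_def node_def)
  obtain m2 where m2: "reach 2 (19, m1) (21, m2)"
    "represents m2 (partial_inv (Suc j)) p (S @ [(False, Suc j)])" "m2 x_r = m1 x_r"
    using reach_push[OF rep1 _ _ _ x1, of 19] j prog_nth by auto
  define m3 where "m3 = m2(v_r := m2 x_r + m2 k2_r)"
  have r3: "reach 1 (21, m2) (22, m3)" unfolding m3_def by (rule run_add_v)
  have rep3: "represents m3 (partial_inv (Suc j)) p (S @ [(False, Suc j)])"
    unfolding m3_def by (intro represents_scratch m2(2)) simp_all
  have v3: "m3 v_r = node True (Suc j)"
    using m2(3) x1 represents_regs[OF m2(2)] by (simp add: m3_def node_def)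
  obtain m4 where m4: "reach 2 (22, m3) (24, m4)"
    "represents m4 (partial_inv (Suc j)) p (S @ [(False, Suc j)] @ [(True, Suc j)])" "m4 x_r = m3 x_r"
    using reach_push[OF rep3 _ _ _ v3, of 22] j prog_nth by auto
  have "reach (6 + 2 + 1 + 2 + 1) (init_l, m) (init_l, m4)"
    using r1 m2(1) r3 m4(1) run_jump_init[of m4] by (meson reach_trans)
  moreover have "m4 x_r = int (Suc j)" using m4(3) m2(3) x1 by (simp add: m3_def node_def)
  ultimately show ?thesis using m4(2) by auto
qed

lemma reach_init:
  assumes "represents m (partial_inv j) p (all_nodes j)" "m x_r = int j" "j \<le> k"
  shows "\<exists>m'. reach (12 * (k - j) + 1) (init_l, m) (loop_l, m') \<and> represents m' pos_of p (all_nodes k)"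
  using assms
proof (induction "k - j" arbitrary: j m)
  case 0
  then have "reach 1 (init_l, m) (loop_l, m)"
    using represents_regs[OF 0(2)] by (intro run_init_done) simp
  moreover have "k = j" using 0 by simp
  ultimately show ?case using 0(2) partial_inv_k by auto
next
  case (Suc d)
  then have j: "Suc j \<le> k" and d: "d = k - Suc j" by simp_all
  obtain m1 where m1: "reach 12 (init_l, m) (init_l, m1)" "m1 x_r = int (Suc j)"
    "represents m1 (partial_inv (Suc j)) p (all_nodes (Suc j))"
    using reach_init_step[OF Suc(3,4) j] by auto
  obtain m' where m': "reach (12 * (k - Suc j) + 1) (init_l, m1) (loop_l, m')"
    "represents m' pos_of p (all_nodes k)"
    using Suc(1)[OF d m1(3,2) j] by blast
  have "12 + (12 * (k - Suc j) + 1) = 12 * (k - j) + 1" using j by simp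
  then show ?case using reach_trans[OF m1(1) m'(1)] m'(2) by auto
qed

section \<open>One iteration of the main loop\<close>

lemma reach_pop:
  assumes "represents m w p (S @ [(c, x)])"
  shows "\<exists>m'. reach 8 (loop_l, m) (node_l, m') \<and> represents m' w p S \<and>
    m' v_r = node c x \<and> m' x_r = int x \<and> m' off_r = node c 0"
proof -
  note regs = represents_regs[OF assms] and pop = represents_pop[OF assms]
  define m' where "m' = m(sp_r := m sp_r + 1, v_r := node c x,
    x_r := (if node c x \<le> m k1_r then node c x else node c x - m k2_r),
    off_r := (if node c x \<le> m k1_r then 0 else m k2_r))"
  have "reach 8 (loop_l, m) (node_l, m')"
    unfolding m'_def by (rule run_pop) (use regs pop(2) in simp_all)
  moreover have "represents m' w p S"
    unfolding m'_def by (intro represents_scratch pop(1)) simp_all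
  moreover have "m' v_r = node c x \<and> m' x_r = int x \<and> m' off_r = node c 0"
    using pop(3) regs by (auto simp: m'_def node_def)
  ultimately show ?thesis by blast
qed

lemma reach_skip:
  assumes rep: "represents m w p S" and "m v_r = node c x" "m x_r = int x" "x \<le> k + 1"
    and skip: "\<not> (x \<in> {1..k} \<and> p c x \<le> n)"
  shows "\<exists>m'. reach 5 (node_l, m) (loop_l, m') \<and> represents m' w p S"
proof -
  note regs = represents_regs[OF rep]
  have ptr: "m (m ptr_r + m v_r) = int (p c x)"
    by (rule represents_ptr[OF rep]) (use regs assms in simp_all)
  have "\<exists>a b. reach 5 (node_l, m) (loop_l, m(a_r := a, q_r := b))"
    by (rule run_skip) (use regs assms ptr node_nonneg[of c x] in auto)
  then obtain a b where "reach 5 (node_l, m) (loop_l, m(a_r := a, q_r := b))" by blast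
  moreover have "represents (m(a_r := a, q_r := b)) w p S"
    by (intro represents_scratch rep) simp_all
  ultimately show ?thesis by blast
qed

text \<open>The copies tested in turn, held as offsets in \<open>o1_r\<close> and
  \<open>o2_r\<close>. For a non-fixed position they coincide, which the program recognises after a
  failed test in order to start the scan.\<close>

definition first_copy :: "bool \<Rightarrow> nat \<Rightarrow> bool" where
  "first_copy c x \<longleftrightarrow> \<pi> x \<noteq> x \<and> c"

definition second_copy :: "bool \<Rightarrow> nat \<Rightarrow> bool" where
  "second_copy c x \<longleftrightarrow> \<pi> x = x \<or> c"

lemma good_iff:
  "good p c x \<longleftrightarrow>
    supported p (first_copy c x) x (p c x) \<or> supported p (second_copy c x) x (p c x)"
  by (cases c) (auto simp: good_def first_copy_def second_copy_def)

lemma reach_node: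
  assumes rep: "represents m w p S" and "m v_r = node c x" "m x_r = int x" "m off_r = node c 0"
    and x: "x \<in> {1..k}" and le: "p c x \<le> n"
  shows "\<exists>m'. reach 19 (node_l, m) (check_l, m') \<and> represents m' w p S \<and>
    m' v_r = node c x \<and> m' x_r = int x \<and> m' y_r = int (\<pi> x) \<and> m' q_r = int (p c x) \<and>
    m' t_r = int (T (p c x)) \<and> m' up_r = (if upper c x then 1 else 0) \<and>
    m' o1_r = node (first_copy c x) 0 \<and> m' o2_r = node (second_copy c x) 0"
proof -
  note regs = represents_regs[OF rep]
  have ptr: "m (m ptr_r + m v_r) = int (p c x)"
    by (rule represents_ptr[OF rep]) (use regs assms in simp_all)
  have pi: "m (m n1_r + m x_r) = int (\<pi> x)"
    using represents_input[OF rep, of "n + x" "m n1_r + m x_r"] T_pi[OF x] x regs assms(3) by simp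
  have tau: "m (int (p c x) + 1) = int (T (p c x))"
    by (rule represents_input[OF rep]) (use le in simp_all)
  define m' where "m' = m(q_r := int (p c x), y_r := int (\<pi> x), a_r := int (p c x) + 1,
    t_r := int (T (p c x)), o1_r := (if m x_r = int (\<pi> x) then 0 else m off_r),
    o2_r := (if m x_r = int (\<pi> x) then m k2_r else m off_r),
    up_r := (if m x_r < int (\<pi> x) \<or> m x_r = int (\<pi> x) \<and> m off_r < m k2_r then 1 else 0))"
  have "reach 19 (node_l, m) (check_l, m')"
    unfolding m'_def
    by (rule run_node) (use regs assms ptr pi tau node_nonneg[of c x] in auto)
  moreover have "represents m' w p S"
    unfolding m'_def by (intro represents_scratch rep) simp_all
  moreover have "m' up_r = (if upper c x then 1 else 0)" "m' o1_r = node (first_copy c x) 0"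
    "m' o2_r = node (second_copy c x) 0"
    using assms(3,4) regs
    by (cases c; auto simp: m'_def upper_def first_copy_def second_copy_def node_def)+
  ultimately show ?thesis using assms(2,3) by (intro exI[of _ m']) (simp add: m'_def)
qed

lemma reach_check:
  assumes rep: "represents m pos_of p S" and "m x_r = int x" "m y_r = int (\<pi> x)" "m q_r = int q"
    and "m t_r = int (T q)" "m o1_r = node d 0"
    and x: "x \<in> {1..k}" and le: "\<And>c x. p c x \<le> n + 1"
  shows "\<exists>a b. reach 15 (check_l, m)
    (if supported p d x q then loop_l else fail_l, m(b_r := b, a_r := a))"
proof -
  note regs = represents_regs[OF rep]
  have pi_in: "\<pi> x \<in> {1..k}" using is_perm_in[OF perm_pi x] .
  have l: "m (m ptr_r + m o1_r + m x_r - m one_r) = int (p d (x - 1))"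
    by (rule represents_ptr[OF rep]) (use regs assms in \<open>auto simp: node_def of_nat_diff\<close>)
  have j: "m (m y_r - m one_r + m inv_r) = int (pos_of (\<pi> x - 1))"
    by (rule represents_inv[OF rep]) (use regs assms pi_in in \<open>auto simp: of_nat_diff\<close>)
  have b: "m (int (pos_of (\<pi> x - 1)) + m o1_r + m ptr_r) = int (p d (pos_of (\<pi> x - 1)))"
    by (rule represents_ptr[OF rep])
      (use regs assms pos_of_le[of "\<pi> x - 1"] in \<open>auto simp: node_def\<close>)
  \<comment> \<open>The pointer may be \<open>n + 1\<close>. The existence of \<open>x\<close> gives
    \<open>k \<ge> 1\<close>, so the cell read still belongs to the input block.\<close>
  have t: "m (int (p d (pos_of (\<pi> x - 1))) + m one_r) = int (T (p d (pos_of (\<pi> x - 1))))"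
    using le[of d "pos_of (\<pi> x - 1)"] x regs by (intro represents_input[OF rep]) auto
  have "\<exists>a. reach 15 (check_l, m)
    (if int (p d (x - 1)) < m q_r \<and> int (T (p d (pos_of (\<pi> x - 1)))) < m t_r then loop_l else fail_l,
     m(b_r := int (p d (x - 1)), a_r := a))"
    by (rule run_check[OF _ l _ j _ b _ t])
      (use regs assms(2,3,6) x pi_in node_nonneg[of d 0] in auto)
  then show ?thesis unfolding supported_def assms(4,5) of_nat_less_iff by blast
qed

text \<open>The bound is \<open>2 * (15 + 3)\<close>: at most two support tests, each followed on
  failure by the branch to the second test or to the scan.\<close>

lemma reach_decide:
  assumes rep: "represents m pos_of p S" and x: "m x_r = int x" "x \<in> {1..k}"
    and "m y_r = int (\<pi> x)" "m q_r = int (p c x)" "m t_r = int (T (p c x))"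
    and "m o1_r = node (first_copy c x) 0" "m o2_r = node (second_copy c x) 0"
    and le: "\<And>c x. p c x \<le> n + 1"
  shows "\<exists>m'. reach 36 (check_l, m) (if good p c x then loop_l else scan_l, m') \<and>
    represents m' pos_of p S \<and> (\<forall>r\<in>{v_r, x_r, y_r, q_r, up_r}. m' r = m r)"
proof -
  let ?q = "p c x" and ?c = "first_copy c x" and ?d = "second_copy c x"
  note regs = represents_regs[OF rep]
  obtain a b where r1: "reach 15 (check_l, m)
    (if supported p ?c x ?q then loop_l else fail_l, m(b_r := b, a_r := a))"
    using reach_check[OF rep x(1) assms(4-7) x(2) le] by blast
  define m1 where "m1 = m(b_r := b, a_r := a)"
  have rep1: "represents m1 pos_of p S"
    unfolding m1_def by (intro represents_scratch rep) simp_all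
  have m1_regs: "\<forall>r\<in>{v_r, x_r, y_r, q_r, t_r, up_r, o1_r, o2_r, zero_r}. m1 r = m r"
    by (simp add: m1_def)
  show ?thesis
  proof (cases "supported p ?c x ?q")
    case True
    then have "reach 36 (check_l, m) (loop_l, m1)"
      using r1 by (auto simp: m1_def elim: reach_mono)
    moreover have "good p c x" using True by (simp add: good_iff)
    ultimately show ?thesis using rep1 m1_regs by (intro exI[of _ m1]) simp
  next
    case False
    then have fail1: "reach 15 (check_l, m) (fail_l, m1)" using r1 by (simp add: m1_def)
    have f1: "reach 3 (fail_l, m1)
      (if m1 o2_r \<le> m1 o1_r then (scan_l, m1) else (check_l, m1(o1_r := m1 o2_r)))"
      by (rule run_fail) (use m1_regs regs in simp)
    show ?thesis
    proof (cases "\<pi> x = x")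
      case nofix: False
      then have eq: "?c = ?d" by (simp add: first_copy_def second_copy_def)
      then have "reach 3 (fail_l, m1) (scan_l, m1)"
        using f1 m1_regs assms(7,8) by simp
      then have "reach 36 (check_l, m) (scan_l, m1)"
        using reach_mono[OF reach_trans[OF fail1]] by simp
      moreover have "\<not> good p c x" using False eq by (simp add: good_iff)
      ultimately show ?thesis using rep1 m1_regs by (intro exI[of _ m1]) simp
    next
      case True
      then have cd: "\<not> ?c" "?d" by (auto simp: first_copy_def second_copy_def)
      define m2 where "m2 = m1(o1_r := m1 o2_r)"
      have rep2: "represents m2 pos_of p S"
        unfolding m2_def by (intro represents_scratch rep1) simp_all
      have m2_regs: "\<forall>r\<in>{v_r, x_r, y_r, q_r, t_r, up_r, o2_r, zero_r}. m2 r = m r"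
        "m2 o1_r = node ?d 0"
        using m1_regs assms(8) by (simp_all add: m2_def)
      have "m1 o1_r < m1 o2_r"
        using m1_regs assms(7,8) cd by (simp add: node_def)
      then have f2: "reach (15 + 3) (check_l, m) (check_l, m2)"
        using reach_trans[OF fail1 f1] by (simp add: m2_def)
      obtain a b where r2: "reach 15 (check_l, m2)
        (if supported p ?d x ?q then loop_l else fail_l, m2(b_r := b, a_r := a))"
        using reach_check[OF rep2 _ _ _ _ m2_regs(2) x(2) le, of ?q] m2_regs(1) x assms(4-6) by auto
      define m3 where "m3 = m2(b_r := b, a_r := a)"
      have rep3: "represents m3 pos_of p S"
        unfolding m3_def by (intro represents_scratch rep2) simp_all
      have m3_regs: "\<forall>r\<in>{v_r, x_r, y_r, q_r, t_r, up_r, zero_r}. m3 r = m r" "m3 o1_r = m3 o2_r"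
        using m2_regs assms(8) by (simp_all add: m3_def)
      have r3: "reach (15 + 3 + 15) (check_l, m) (if supported p ?d x ?q then loop_l else fail_l, m3)"
        using reach_trans[OF f2 r2] by (simp add: m3_def)
      have f3: "reach 3 (fail_l, m3) (scan_l, m3)"
        using run_fail[of m3] m3_regs regs by simp
      have "reach 36 (check_l, m) (if good p c x then loop_l else scan_l, m3)"
      proof (cases "supported p ?d x ?q")
        case True
        then have "good p c x" by (simp add: good_iff)
        then show ?thesis using True reach_mono[OF r3] by simp
      next
        case nsupp: False
        then have "\<not> good p c x" using False by (simp add: good_iff)
        moreover have "reach (15 + 3 + 15 + 3) (check_l, m) (scan_l, m3)"
          using r3 nsupp by (intro reach_trans[OF _ f3]) simp
        ultimately show ?thesis by simp
      qed
      then show ?thesis using rep3 m3_regs by (intro exI[of _ m3]) simp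
    qed
  qed
qed

lemma reach_scan:
  assumes "represents m w p S" "m q_r = int q" "q \<le> n" "m up_r = (if u then 1 else 0)"
  shows "\<exists>m' q'. reach (7 * (q' - q)) (scan_l, m) (store_l, m') \<and> represents m' w p S \<and>
    m' q_r = int q' \<and> (\<forall>r\<in>{v_r, x_r, y_r}. m' r = m r) \<and>
    q < q' \<and> q' \<le> n + 1 \<and> (q' \<le> n \<longrightarrow> on_chain u q') \<and> (\<forall>r. q < r \<and> r < q' \<longrightarrow> \<not> on_chain u r)"
  using assms
proof (induction "n - q" arbitrary: q m rule: less_induct)
  case less
  note regs = represents_regs[OF less(2)]
  have "\<exists>a b. reach 7 (scan_l, m)
    (if m n1_r \<le> m q_r + 1 \<or> (u \<longleftrightarrow> m q_r + 1 \<le> m (2 + m q_r)) then store_l else scan_l,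
     m(q_r := m q_r + 1, a_r := a, t_r := b))"
    by (rule run_scan) (use regs less.prems in simp_all)
  then obtain a b where ab: "reach 7 (scan_l, m)
    (if m n1_r \<le> m q_r + 1 \<or> (u \<longleftrightarrow> m q_r + 1 \<le> m (2 + m q_r)) then store_l else scan_l,
     m(q_r := m q_r + 1, a_r := a, t_r := b))" by blast
  define m1 where "m1 = m(q_r := m q_r + 1, a_r := a, t_r := b)"
  have rep1: "represents m1 w p S"
    unfolding m1_def by (intro represents_scratch less.prems) simp_all
  have m1_regs: "m1 q_r = int (Suc q)" "m1 up_r = m up_r" "\<forall>r\<in>{v_r, x_r, y_r}. m1 r = m r"
    using less.prems by (simp_all add: m1_def)
  have tau: "m (2 + m q_r) = int (T (Suc q))" if "q < n"
    by (rule represents_input[OF less(2)]) (use that less.prems in simp_all)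
  \<comment> \<open>At \<open>q = n\<close> the scan ends whatever the next cell contains, so the
    comparison with a text value matters only for \<open>q < n\<close>.\<close>
  have stop: "m n1_r \<le> m q_r + 1 \<or> (u \<longleftrightarrow> m q_r + 1 \<le> m (2 + m q_r)) \<longleftrightarrow> q = n \<or> on_chain u (Suc q)"
  proof (cases "q = n")
    case False
    then have "q < n" using less.prems by simp
    then show ?thesis using tau regs less.prems by (auto simp: on_chain_def)
  qed (use regs less.prems in simp)
  show ?case
  proof (cases "q = n \<or> on_chain u (Suc q)")
    case True
    then have "reach 7 (scan_l, m) (store_l, m1)" using ab stop by (simp add: m1_def)
    then show ?thesis using True rep1 m1_regs less.prems
      by (intro exI[of _ m1] exI[of _ "Suc q"]) auto
  next
    case False
    then have r: "reach 7 (scan_l, m) (scan_l, m1)" using ab stop by (simp add: m1_def)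
    have "n - Suc q < n - q" "Suc q \<le> n" using False less.prems by auto
    then obtain m' q' where q': "reach (7 * (q' - Suc q)) (scan_l, m1) (store_l, m')"
      "represents m' w p S" "m' q_r = int q'" "\<forall>r\<in>{v_r, x_r, y_r}. m' r = m1 r"
      "Suc q < q'" "q' \<le> n + 1" "q' \<le> n \<longrightarrow> on_chain u q'"
      "\<forall>r. Suc q < r \<and> r < q' \<longrightarrow> \<not> on_chain u r"
      using less(1)[of "Suc q" m1] rep1 m1_regs less.prems by auto
    have "7 + 7 * (q' - Suc q) = 7 * (q' - q)" using q'(5) by simp
    then have "reach (7 * (q' - q)) (scan_l, m) (store_l, m')"
      using reach_trans[OF r q'(1)] by simp
    moreover have "\<not> on_chain u r" if "q < r" "r < q'" for r
      using that q'(8) False by (cases "r = Suc q") auto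
    ultimately show ?thesis using q' m1_regs(3) by (intro exI[of _ m'] exI[of _ q']) auto
  qed
qed

lemma reach_store:
  assumes rep: "represents m pos_of p S" and "m q_r = int q" "m v_r = node c x" "m x_r = int x"
    and "m y_r = int (\<pi> x)" and x: "x \<in> {1..k}"
  shows "\<exists>m'. reach 19 (store_l, m) (loop_l, m') \<and>
    represents m' pos_of (move p c x q) (S @ next_nodes c x)"
proof -
  let ?p = "move p c x q"
  note regs = represents_regs[OF rep]
  have pi_in: "\<pi> x \<in> {1..k}" using is_perm_in[OF perm_pi x] .
  define m1 where "m1 = m(a_r := m ptr_r + m v_r, m ptr_r + m v_r := m q_r)"
  have r1: "reach 2 (store_l, m) (82, m1)"
    unfolding m1_def by (rule run_store) (use regs assms(3) node_nonneg[of c x] in simp)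
  have "represents (m(a_r := m ptr_r + m v_r)) pos_of p S"
    by (intro represents_scratch rep) simp_all
  from represents_set_ptr[OF this, of x c q] have rep1: "represents m1 pos_of ?p S"
    using x assms(2,3) by (simp add: m1_def)
  have m1_regs: "m1 v_r = node c x" "m1 x_r = int x" "m1 y_r = int (\<pi> x)"
    using regs assms node_nonneg[of c x] by (simp_all add: m1_def)
  obtain m2 where m2: "reach 2 (82, m1) (84, m2)" "represents m2 pos_of ?p (S @ [(c, x)])"
    "m2 x_r = int x" "m2 y_r = int (\<pi> x)"
    using reach_push[OF rep1 _ _ _ m1_regs(1), of 82] x m1_regs prog_nth by auto
  define m3 where "m3 = m2(b_r := m2 x_r + m2 one_r)"
  have r3: "reach 1 (84, m2) (85, m3)" unfolding m3_def by (rule run_right)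
  have rep3: "represents m3 pos_of ?p (S @ [(c, x)])"
    unfolding m3_def by (intro represents_scratch m2(2)) simp_all
  have b3: "m3 b_r = node False (x + 1)"
    using m2(3) represents_regs[OF m2(2)] by (simp add: m3_def node_def)
  obtain m4 where m4: "reach 2 (85, m3) (87, m4)"
    "represents m4 pos_of ?p ((S @ [(c, x)]) @ [(False, x + 1)])" "m4 b_r = m3 b_r" "m4 y_r = m3 y_r"
    using reach_push[OF rep3 _ _ _ b3, of 85] x prog_nth by auto
  define m5 where "m5 = m4(b_r := m4 b_r + m4 k2_r)"
  have r5: "reach 1 (87, m4) (88, m5)" unfolding m5_def by (rule run_copy)
  have rep5: "represents m5 pos_of ?p ((S @ [(c, x)]) @ [(False, x + 1)])"
    unfolding m5_def by (intro represents_scratch m4(2)) simp_all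
  have b5: "m5 b_r = node True (x + 1)"
    using m4(3) b3 represents_regs[OF m4(2)] by (simp add: m5_def node_def)
  obtain m6 where m6: "reach 2 (88, m5) (90, m6)"
    "represents m6 pos_of ?p (((S @ [(c, x)]) @ [(False, x + 1)]) @ [(True, x + 1)])" "m6 y_r = m5 y_r"
    using reach_push[OF rep5 _ _ _ b5, of 88] x prog_nth by auto
  have y6: "m6 y_r = int (\<pi> x)" using m6(3) m4(4) m2(4) by (simp add: m5_def m3_def)
  note regs6 = represents_regs[OF m6(2)]
  have above: "m6 (m6 y_r + m6 one_r + m6 inv_r) = int (pos_of (\<pi> x + 1))"
    by (rule represents_inv[OF m6(2)]) (use y6 pi_in regs6 in auto)
  define m7 where "m7 = m6(a_r := m6 y_r + m6 one_r + m6 inv_r, b_r := int (pos_of (\<pi> x + 1)))"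
  have r7: "reach 3 (90, m6) (93, m7)"
    unfolding m7_def by (rule run_above) (use y6 regs6 above in simp_all)
  have rep7: "represents m7 pos_of ?p (((S @ [(c, x)]) @ [(False, x + 1)]) @ [(True, x + 1)])"
    unfolding m7_def by (intro represents_scratch m6(2)) simp_all
  have b7: "m7 b_r = node False (pos_of (\<pi> x + 1))" by (simp add: m7_def node_def)
  have ivk: "pos_of (\<pi> x + 1) \<le> k + 1" using pos_of_le[of "\<pi> x + 1"] by simp
  obtain m8 where m8: "reach 2 (93, m7) (95, m8)"
    "represents m8 pos_of ?p ((((S @ [(c, x)]) @ [(False, x + 1)]) @ [(True, x + 1)]) @
      [(False, pos_of (\<pi> x + 1))])" "m8 b_r = m7 b_r"
    using reach_push[OF rep7 _ _ _ b7 ivk, of 93] prog_nth by auto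
  define m9 where "m9 = m8(b_r := m8 b_r + m8 k2_r)"
  have r9: "reach 1 (95, m8) (96, m9)" unfolding m9_def by (rule run_copy)
  have rep9: "represents m9 pos_of ?p ((((S @ [(c, x)]) @ [(False, x + 1)]) @ [(True, x + 1)]) @
      [(False, pos_of (\<pi> x + 1))])"
    unfolding m9_def by (intro represents_scratch m8(2)) simp_all
  have b9: "m9 b_r = node True (pos_of (\<pi> x + 1))"
    using m8(3) b7 represents_regs[OF m8(2)] by (simp add: m9_def node_def)
  obtain m10 where m10: "reach 2 (96, m9) (98, m10)"
    "represents m10 pos_of ?p (((((S @ [(c, x)]) @ [(False, x + 1)]) @ [(True, x + 1)]) @
      [(False, pos_of (\<pi> x + 1))]) @ [(True, pos_of (\<pi> x + 1))])"
    using reach_push[OF rep9 _ _ _ b9 ivk, of 96] prog_nth by auto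
  have "reach (2 + 2 + 1 + 2 + 1 + 2 + 3 + 2 + 1 + 2 + 1) (store_l, m) (loop_l, m10)"
    by (intro reach_trans[OF _ run_jump_loop[of m10]] reach_trans[OF _ m10(1)] reach_trans[OF _ r9]
      reach_trans[OF _ m8(1)] reach_trans[OF _ r7] reach_trans[OF _ m6(1)] reach_trans[OF _ r5]
      reach_trans[OF _ m4(1)] reach_trans[OF _ r3] reach_trans[OF _ m2(1)] r1)
  then show ?thesis using m10(2) by (auto simp: next_nodes_def)
qed

text \<open>An iteration takes at most 82 steps plus 7 for each text position passed, and moving a pointer
  lengthens the stack by four.\<close>
definition cost :: "(bool \<Rightarrow> nat \<Rightarrow> nat) \<Rightarrow> (bool \<times> nat) list \<Rightarrow> nat" where
  "cost p S = 100 * length S + 600 * slack p"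

lemma reach_iteration:
  assumes rep: "represents m pos_of p (S @ [(c, x)])" and inv: "search_inv p (S @ [(c, x)])"
  shows "\<exists>m' p' S' t. reach t (loop_l, m) (loop_l, m') \<and> represents m' pos_of p' S' \<and>
    search_inv p' S' \<and> 0 < t \<and> t + cost p' S' \<le> cost p (S @ [(c, x)])"
proof -
  obtain m1 where m1: "reach 8 (loop_l, m) (node_l, m1)" "represents m1 pos_of p S"
    "m1 v_r = node c x" "m1 x_r = int x" "m1 off_r = node c 0"
    using reach_pop[OF rep] by blast
  note xk = represents_pop(3)[OF rep]
  have le: "p c x \<le> n + 1" for c x using inv by (simp add: search_inv_def)
  \<comment> \<open>The number 63 exceeds both the 5 steps for a skipped node and the
    \<open>19 + 36\<close> for a node found good.\<close>
  have drop: ?thesis if "reach 63 (node_l, m1) (loop_l, m')" "represents m' pos_of p S"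
    "x \<in> {1..k} \<and> p c x \<le> n \<longrightarrow> good p c x" for m'
    using reach_trans[OF m1(1) that(1)] that(2) search_inv_drop[OF inv that(3)]
    by (intro exI[of _ m'] exI[of _ p] exI[of _ S] exI[of _ "8 + 63"]) (simp add: cost_def)
  show ?thesis
  proof (cases "x \<in> {1..k} \<and> p c x \<le> n")
    case False
    then obtain m' where "reach 5 (node_l, m1) (loop_l, m')" "represents m' pos_of p S"
      using reach_skip[OF m1(2-4) xk] by blast
    then show ?thesis using drop[of m'] False reach_mono[of 5 _ _ 63] by fastforce
  next
    case True
    obtain m2 where m2: "reach 19 (node_l, m1) (check_l, m2)" "represents m2 pos_of p S"
      "m2 v_r = node c x" "m2 x_r = int x" "m2 y_r = int (\<pi> x)" "m2 q_r = int (p c x)"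
      "m2 t_r = int (T (p c x))" "m2 up_r = (if upper c x then 1 else 0)"
      "m2 o1_r = node (first_copy c x) 0" "m2 o2_r = node (second_copy c x) 0"
      using reach_node[OF m1(2-5)] True by blast
    obtain m3 where m3: "reach 36 (check_l, m2) (if good p c x then loop_l else scan_l, m3)"
      "represents m3 pos_of p S" "\<forall>r\<in>{v_r, x_r, y_r, q_r, up_r}. m3 r = m2 r"
      using reach_decide[OF m2(2,4) _ m2(5-7,9,10) le] True by blast
    note r3 = reach_trans[OF m2(1) m3(1)]
    show ?thesis
    proof (cases "good p c x")
      case True
      then have "reach 63 (node_l, m1) (loop_l, m3)" using reach_mono[OF r3] by simp
      then show ?thesis using drop[of m3] m3(2) True by simp
    next
      case bad: False
      obtain m4 q where m4: "reach (7 * (q - p c x)) (scan_l, m3) (store_l, m4)"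
        "represents m4 pos_of p S" "m4 q_r = int q" "\<forall>r\<in>{v_r, x_r, y_r}. m4 r = m3 r"
        and q: "p c x < q" "q \<le> n + 1" "q \<le> n \<longrightarrow> on_chain (upper c x) q"
        "\<forall>r. p c x < r \<and> r < q \<longrightarrow> \<not> on_chain (upper c x) r"
        using reach_scan[OF m3(2), of "p c x" "upper c x"] True m3(3) m2(6,8) by auto
      have adv: "advances p c x q" using q by (simp add: advances_def)
      obtain m5 where m5: "reach 19 (store_l, m4) (loop_l, m5)"
        "represents m5 pos_of (move p c x q) (S @ next_nodes c x)"
        using reach_store[OF m4(2,3)] m4(4) m3(3) m2(3-5) True by auto
      have "reach (19 + 36) (node_l, m1) (scan_l, m3)" using r3 bad by simp
      from reach_trans[OF reach_trans[OF reach_trans[OF m1(1) this] m4(1)] m5(1)]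
      have r: "reach (8 + (19 + 36) + 7 * (q - p c x) + 19) (loop_l, m) (loop_l, m5)" .
      have "search_inv (move p c x q) (S @ next_nodes c x)"
        using search_inv_move[OF inv _ bad adv] True by blast
      \<comment> \<open>With \<open>d = q - p c x \<ge> 1\<close>, the \<open>82 + 7 * d\<close>
        steps and the \<open>4 * 100\<close> for the longer stack are together at most
        \<open>600 * d\<close>.\<close>
      moreover have "8 + (19 + 36) + 7 * (q - p c x) + 19 + cost (move p c x q) (S @ next_nodes c x)
          \<le> cost p (S @ [(c, x)])"
        using slack_move[of x p c q] True adv q(1) by (simp add: cost_def next_nodes_def)
      ultimately show ?thesis using r m5(2)
        by (intro exI[of _ m5] exI[of _ "move p c x q"] exI[of _ "S @ next_nodes c x"]
          exI[of _ "8 + (19 + 36) + 7 * (q - p c x) + 19"]) simp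
    qed
  qed
qed

text \<open>Each iteration pays for its steps out of \<open>cost\<close>, which is thus both the
  termination measure and the time bound. The additional step is the final test for the empty
  stack.\<close>

lemma reach_loop:
  assumes "represents m pos_of p S" "search_inv p S"
  shows "\<exists>m' p'. reach (cost p S + 1) (loop_l, m) (finish_l, m') \<and> represents m' pos_of p' [] \<and>
    search_inv p' []"
  using assms
proof (induction "cost p S" arbitrary: m p S rule: less_induct)
  case less
  show ?case
  proof (cases S rule: rev_cases)
    case Nil
    then have "reach 1 (loop_l, m) (finish_l, m)"
      using represents_regs[OF less(2)] by (intro run_empty) simp
    then have "reach (cost p S + 1) (loop_l, m) (finish_l, m)" by (rule reach_mono) simp
    then show ?thesis using less.prems Nil by blast
  next
    case (snoc S' cx)
    obtain c x where "cx = (c, x)" by force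
    then obtain m1 p1 S1 t where s: "reach t (loop_l, m) (loop_l, m1)" "represents m1 pos_of p1 S1"
      "search_inv p1 S1" "0 < t" "t + cost p1 S1 \<le> cost p S"
      using reach_iteration[of m p S' c x] less.prems snoc by blast
    then have "cost p1 S1 < cost p S" by linarith
    then obtain m' p' where m': "reach (cost p1 S1 + 1) (loop_l, m1) (finish_l, m')"
      "represents m' pos_of p' []" "search_inv p' []"
      using less(1) s(2,3) by blast
    have "reach (cost p S + 1) (loop_l, m) (finish_l, m')"
      using reach_mono[OF reach_trans[OF s(1) m'(1)]] s(5) by simp
    then show ?thesis using m' by blast
  qed
qed

lemma reach_result:
  assumes "represents m (\<lambda>y. 0) (\<lambda>c x. 0) []" "m x_r = 0"
  shows "\<exists>m'. reach (12 * k + (cost (\<lambda>c x. 0) (all_nodes k) + 10)) (init_l, m) (end_l, m') \<and>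
    m' 0 = (if contains n T k \<pi> then 1 else 0)"
proof -
  obtain m1 where m1: "reach (12 * k + 1) (init_l, m) (loop_l, m1)"
    "represents m1 pos_of (\<lambda>c x. 0) (all_nodes k)"
    using reach_init[of m 0 "\<lambda>c x. 0"] assms partial_inv_0 by auto
  obtain m2 p where m2: "reach (cost (\<lambda>c x. 0) (all_nodes k) + 1) (loop_l, m1) (finish_l, m2)"
    "represents m2 pos_of p []" "search_inv p []"
    using reach_loop[OF m1(2)] search_inv_init set_all_nodes by blast
  note regs = represents_regs[OF m2(2)]
  have p: "m2 (m2 ptr_r + m2 k_r) = int (p False k)" "m2 (m2 ptr_r + m2 k_r + m2 k2_r) = int (p True k)"
    by (rule represents_ptr[OF m2(2)]; use regs in \<open>simp add: node_def\<close>)+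
  have "\<exists>m'. reach 8 (finish_l, m2) (end_l, m') \<and>
    m' 0 = (if m2 (m2 ptr_r + m2 k_r) \<le> m2 0 \<or> m2 (m2 ptr_r + m2 k_r + m2 k2_r) \<le> m2 0 then 1 else 0)"
    by (rule run_finish) (use regs in simp_all)
  then obtain m3 where m3: "reach 8 (finish_l, m2) (end_l, m3)"
    "m3 0 = (if contains n T k \<pi> then 1 else 0)"
    using search_inv_result[OF m2(3)] p regs(1) by auto
  have "reach (12 * k + (cost (\<lambda>c x. 0) (all_nodes k) + 10)) (init_l, m) (end_l, m3)"
    by (rule reach_mono[OF reach_trans[OF reach_trans[OF m1(1) m2(1)] m3(1)]]) simp
  then show ?thesis using m3(2) by blast
qed

text \<open>The stack contributes \<open>100 * 2k\<close> and the slack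
  \<open>600 * 2k(n + 1)\<close>, in total \<open>1200kn + 1400k\<close>. The bound
  \<open>k \<le> k * n\<close> absorbs the linear term: if \<open>k \<le> n\<close>, then
  \<open>n = 0\<close> forces \<open>k = 0\<close>.\<close>

lemma cost_init:
  assumes "k \<le> n"
  shows "cost (\<lambda>c x. 0) (all_nodes k) \<le> 2600 * (k * n)"
proof -
  have "k \<le> k * n" using assms by (cases "n = 0") auto
  then show ?thesis by (simp add: cost_def length_all_nodes slack_def algebra_simps)
qed

end

section \<open>From the input memory to the answer\<close>

lemma contains_cong:
  assumes "\<And>i. i \<in> {1..n} \<Longrightarrow> \<tau> i = T i"
  shows "contains n \<tau> k \<pi> \<longleftrightarrow> contains n T k \<pi>"
proof -
  have "points n \<tau> = points n T" using assms by (auto simp: points_def)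
  then show ?thesis by (simp add: contains_def is_embedding_def)
qed

lemma prog_correct:
  assumes "is_perm n \<tau>" "avoids_321 n \<tau>" "is_perm k \<pi>" "avoids_321 k \<pi>"
  shows "\<exists>m'. reach (3000 * (k * n + 1)) (0, init_mem n \<tau> k \<pi>) (end_l, m') \<and>
    m' 0 = (if contains n \<tau> k \<pi> then 1 else 0)"
proof -
  define m where "m = init_mem n \<tau> k \<pi>"
  have m: "m 0 = int n" "m 1 = int k" "\<And>a. a < 0 \<Longrightarrow> m a = 0"
    by (auto simp: m_def init_mem_def)
  show ?thesis
  proof (cases "k \<le> n")
    case False
    then have "\<not> contains n \<tau> k \<pi>" using contains_imp_le by blast
    moreover have "reach 5 (0, m) (end_l, m(one_r := 1, k_r := m 1, 0 := 0))"
      by (rule run_reject) (use m False in simp_all)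
    then have "reach (3000 * (k * n + 1)) (0, m) (end_l, m(one_r := 1, k_r := m 1, 0 := 0))"
      by (rule reach_mono) simp
    ultimately show ?thesis unfolding m_def[symmetric] by auto
  next
    case True
    \<comment> \<open>Outside \<open>{1..n}\<close> the function \<open>\<tau>\<close> is arbitrary.
      There \<open>T\<close> takes the values that the machine finds in its memory: the sentinel
      zero in front and the pattern behind.\<close>
    define T where "T i = (if i = 0 then 0 else if i \<le> n then \<tau> i else \<pi> (i - n))" for i
    have T_tau: "\<tau> i = T i" if "i \<in> {1..n}" for i using that by (simp add: T_def)
    have "is_perm n T"
      using assms(1) bij_betw_cong[of "{1..n}" \<tau> T] T_tau by (auto simp: is_perm_def)
    moreover have "avoids_321 n T"
      using assms(2) T_tau unfolding avoids_321_def by metis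
    ultimately interpret matching_machine n k T \<pi>
      using assms(3,4) by unfold_locales (auto simp: T_def)
    define m1 where "m1 = m(one_r := 1, k_r := m 1, 1 := 0, n1_r := m 0 + 1,
      k1_r := m 1 + 1, k2_r := m 1 + 2, inv_r := m 0 + m 1 + 3, ptr_r := m 0 + 2 * m 1 + 5,
      base_r := - 40, sp_r := - 40)"
    have r1: "reach 11 (0, m) (init_l, m1)"
      unfolding m1_def by (rule run_start) (use m True in simp_all)
    have input: "m1 (int i + 1) = int (T i)" if "i \<le> n + k" for i
      using that by (auto simp: m1_def m_def init_mem_def T_def nat_diff_distrib' of_nat_diff)
    have zero: "m1 a = 0" if "int n + int k + 2 \<le> a" for a
      using that by (simp add: m1_def m_def init_mem_def)
    \<comment> \<open>Untouched cells are zero, so the inverse table and all pointers start out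
      correctly without being written.\<close>
    have "represents m1 (\<lambda>y. 0) (\<lambda>c x. 0) []"
      unfolding represents_def
    proof (intro conjI allI impI)
      show "m1 (int n + 2 * int k + 5 + node c x) = int 0" for c x
        using zero node_nonneg[of c x] by simp
    qed (use m input zero in \<open>simp_all add: m1_def\<close>)
    moreover have "m1 x_r = 0" using m by (simp add: m1_def)
    ultimately obtain m' where m':
      "reach (12 * k + (cost (\<lambda>c x. 0) (all_nodes k) + 10)) (init_l, m1) (end_l, m')"
      "m' 0 = (if contains n T k \<pi> then 1 else 0)"
      using reach_result by blast
    have "k \<le> k * n" using True by (cases "n = 0") auto
    \<comment> \<open>The sum is at most \<open>2612 * (k * n) + 21\<close>.\<close>
    then have "11 + (12 * k + (cost (\<lambda>c x. 0) (all_nodes k) + 10)) \<le> 3000 * (k * n + 1)"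
      using cost_init[OF True] unfolding distrib_left by linarith
    then have "reach (3000 * (k * n + 1)) (0, m) (end_l, m')"
      using reach_mono[OF reach_trans[OF r1 m'(1)]] by blast
    then show ?thesis using m'(2) contains_cong[OF T_tau] unfolding m_def by auto
  qed
qed

theorem theorem1:
  shows "\<exists>(P :: instr list) (C :: nat).
    \<forall>n k \<tau> \<pi>.
      is_perm n \<tau> \<and> avoids_321 n \<tau> \<and> is_perm k \<pi> \<and> avoids_321 k \<pi> \<longrightarrow>
      (\<exists>t \<le> C * (k * n + 1).
         halted P ((step P ^^ t) (0, init_mem n \<tau> k \<pi>)) \<and>
         snd ((step P ^^ t) (0, init_mem n \<tau> k \<pi>)) 0 =
           (if contains n \<tau> k \<pi> then 1 else 0))"
proof (rule exI[of _ prog], rule exI[of _ 3000], intro allI impI)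
  fix n k :: nat and \<tau> \<pi> :: "nat \<Rightarrow> nat"
  assume "is_perm n \<tau> \<and> avoids_321 n \<tau> \<and> is_perm k \<pi> \<and> avoids_321 k \<pi>"
  then obtain t m' where "t \<le> 3000 * (k * n + 1)"
    "(step prog ^^ t) (0, init_mem n \<tau> k \<pi>) = (end_l, m')"
    "m' 0 = (if contains n \<tau> k \<pi> then 1 else 0)"
    using prog_correct unfolding reach_def by blast
  then show "\<exists>t \<le> 3000 * (k * n + 1).
      halted prog ((step prog ^^ t) (0, init_mem n \<tau> k \<pi>)) \<and>
      snd ((step prog ^^ t) (0, init_mem n \<tau> k \<pi>)) 0 = (if contains n \<tau> k \<pi> then 1 else 0)"
    by (intro exI[of _ t]) (simp add: halted_def length_prog)
qed

end
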